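(* Let $G$ be a disconnected graph of order $n\geq 6$ and let $s$ be an integer with $2\leq s\leq n-3$. Then $G\in \mathcal{G}^s(n)$ if and only if either $G\cong H+K_1$ for some $H\in \mathcal{G}^{s-1}(n-1)$, or $G\cong K_{t_1,t_2,\ldots,t_p}+K_{r_1,r_2,\ldots,r_q}$ for some positive integers $t_1,\dots,t_p,r_1,\dots,r_q$ with $[(t_1-1)+(t_2-1)+\cdots+(t_p-1)]+[(r_1-1)+(r_2-1)+\cdots+(r_q-1)]=s$.
   Context: All graphs are finite, simple and undirected; eigenvalues of a graph are those of its adjacency matrix. For a graph $G$, $p(G)$ denotes the number of positive eigenvalues and $\eta(G)$ the nullity (multiplicity of eigenvalue $0$). $\mathcal{G}^s(m)$ denotes the set of all graphs on $m$ vertices with $p(G)=2$ and $\eta(G)=s$. $G+H$ denotes the disjoint union of graphs, $K_m$ the complete graph on $m$ vertices, and $K_{n_1,\ldots,n_l}$ the complete multipartite graph with parts of sizes $n_1,\ldots,n_l$. *)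

theory Defs
  imports
    "Graph_Theory.Pair_Digraph"
    "Graph_Theory.Digraph_Isomorphism"
    "Graph_Theory.Kuratowski"
    "Jordan_Normal_Form.Char_Poly"
begin

text \<open>
  A finite simple undirected graph is a \<^locale>\<open>pair_graph\<close>: finitely many vertices, and a
  symmetric, loop-free set of pairs as arcs.
\<close>

definition graph_iso :: "'a pair_pre_digraph \<Rightarrow> 'b pair_pre_digraph \<Rightarrow> bool" (infix "\<cong>\<^sub>g" 50) where
  "G \<cong>\<^sub>g H \<longleftrightarrow> digraph_iso (with_proj G) (with_proj H)"

definition graph_connected :: "'a pair_pre_digraph \<Rightarrow> bool" where
  "graph_connected G \<longleftrightarrow> Digraph_Component.connected (with_proj G)"

definition adjacency_mat :: "'a list \<Rightarrow> 'a pair_pre_digraph \<Rightarrow> real mat" where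
  "adjacency_mat xs G = Matrix.mat (length xs) (length xs)
     (\<lambda>(i, j). if (xs ! i, xs ! j) \<in> parcs G then 1 else 0)"

text \<open>
  The vertices of a graph carry no canonical order, so the adjacency matrix is formed with an
  arbitrary enumeration of them. The eigenvalues do not depend on its choice; see
  \<open>graph_spectrum_eq\<close> below.
\<close>

definition vertex_enum :: "'a pair_pre_digraph \<Rightarrow> 'a list" where
  "vertex_enum G = (SOME xs. distinct xs \<and> set xs = pverts G)"

text \<open>
  The eigenvalues with multiplicity. The adjacency matrix is real and symmetric, so all complex
  roots of its characteristic polynomial are real.
\<close>

definition graph_spectrum :: "'a pair_pre_digraph \<Rightarrow> real multiset" where
  "graph_spectrum G = proots (char_poly (adjacency_mat (vertex_enum G) G))"

definition num_pos_eigenvalues :: "'a pair_pre_digraph \<Rightarrow> nat" where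
  "num_pos_eigenvalues G = size {#x \<in># graph_spectrum G. x > 0#}"

definition nullity :: "'a pair_pre_digraph \<Rightarrow> nat" where
  "nullity G = count (graph_spectrum G) 0"

definition two_pos_graphs :: "nat \<Rightarrow> nat \<Rightarrow> 'a pair_pre_digraph set" (\<open>\<G>\<close>) where
  "\<G> s m = {G. pair_graph G \<and> card (pverts G) = m \<and> num_pos_eigenvalues G = 2 \<and> nullity G = s}"

definition disjoint_union ::
    "'a pair_pre_digraph \<Rightarrow> 'b pair_pre_digraph \<Rightarrow> ('a + 'b) pair_pre_digraph" (infixl "\<oplus>\<^sub>g" 65) where
  "G \<oplus>\<^sub>g H = \<lparr> pverts = pverts G <+> pverts H,
     parcs = {(Inl u, Inl v) | u v. (u, v) \<in> parcs G} \<union> {(Inr u, Inr v) | u v. (u, v) \<in> parcs H} \<rparr>"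

definition complete_graph :: "nat \<Rightarrow> nat pair_pre_digraph" where
  "complete_graph n = \<lparr> pverts = {..<n}, parcs = {(u, v). u < n \<and> v < n \<and> u \<noteq> v} \<rparr>"

text \<open>Vertex \<open>(i, j)\<close> is the \<open>j\<close>-th vertex of the \<open>i\<close>-th part.\<close>

definition complete_multipartite :: "nat list \<Rightarrow> (nat \<times> nat) pair_pre_digraph" where
  "complete_multipartite ts =
     (let V = {(i, j). i < length ts \<and> j < ts ! i}
      in \<lparr> pverts = V, parcs = {(u, v). u \<in> V \<and> v \<in> V \<and> fst u \<noteq> fst v} \<rparr>)"

lemma pair_graph_disjoint_union:
  assumes "pair_graph G" "pair_graph H"
  shows "pair_graph (G \<oplus>\<^sub>g H)"
proof -
  interpret G: pair_graph G by fact
  interpret H: pair_graph H by fact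
  have fin: "finite (parcs (G \<oplus>\<^sub>g H))"
  proof (rule finite_subset)
    show "parcs (G \<oplus>\<^sub>g H) \<subseteq> (pverts G <+> pverts H) \<times> (pverts G <+> pverts H)"
      by (auto simp: disjoint_union_def dest: G.in_arcsD1 G.in_arcsD2 H.in_arcsD1 H.in_arcsD2)
  qed (simp add: G.pair_finite_verts H.pair_finite_verts)
  have "(v, u) \<in> parcs G" if "(u, v) \<in> parcs G" for u v
    using G.pair_sym_arcs that by (auto simp: symmetric_def sym_def)
  moreover have "(v, u) \<in> parcs H" if "(u, v) \<in> parcs H" for u v
    using H.pair_sym_arcs that by (auto simp: symmetric_def sym_def)
  ultimately show ?thesis
    using fin G.pair_finite_verts H.pair_finite_verts
    by unfold_locales
      (auto simp: disjoint_union_def symmetric_def sym_def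
        dest: G.in_arcsD1 G.in_arcsD2 H.in_arcsD1 H.in_arcsD2 G.pair_no_loops H.pair_no_loops)
qed

lemma pair_graph_complete_graph: "pair_graph (complete_graph n)"
proof -
  have "finite (parcs (complete_graph n))"
    by (rule finite_subset[of _ "{..<n} \<times> {..<n}"]) (auto simp: complete_graph_def)
  then show ?thesis
    by unfold_locales (auto simp: complete_graph_def symmetric_def sym_def)
qed

lemma complete_digraph_complete_graph: "complete_digraph n (with_proj (complete_graph n))"
proof -
  interpret pair_graph "complete_graph n" by (rule pair_graph_complete_graph)
  have "graph (with_proj (complete_graph n))" by unfold_locales
  then show ?thesis by (auto simp: complete_digraph_def complete_graph_def)
qed

lemma pair_graph_complete_multipartite: "pair_graph (complete_multipartite ts)"
proof -
  have "{(i, j). i < length ts \<and> j < ts ! i} = Sigma {..<length ts} (\<lambda>i. {..<ts ! i})"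
    by auto
  then have V: "finite (pverts (complete_multipartite ts))"
    by (simp add: complete_multipartite_def Let_def)
  have "finite (parcs (complete_multipartite ts))"
    by (rule finite_subset[OF _ finite_cartesian_product[OF V V]])
      (auto simp: complete_multipartite_def Let_def)
  with V show ?thesis
    by unfold_locales (auto simp: complete_multipartite_def Let_def symmetric_def sym_def)
qed

lemma card_pverts_complete_multipartite: "card (pverts (complete_multipartite ts)) = sum_list ts"
proof -
  have "{(i, j). i < length ts \<and> j < ts ! i} = Sigma {..<length ts} (\<lambda>i. {..<ts ! i})"
    by auto
  then show ?thesis
    by (simp add: complete_multipartite_def Let_def sum_list_sum_nth atLeast0LessThan)
qed

lemma char_poly_adjacency_mat_cong:
  assumes "distinct xs" "distinct ys" "set xs = set ys"
  shows "char_poly (adjacency_mat xs G) = char_poly (adjacency_mat ys G)"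
proof -
  define n where "n = length xs"
  have len: "length ys = n"
    using assms by (metis distinct_card n_def)
  obtain p where p: "p permutes {..<n}" and xs: "\<And>i. i < n \<Longrightarrow> xs ! i = ys ! p i"
  proof -
    have "mset ys = mset xs"
      using assms by (simp add: set_eq_iff_mset_eq_distinct)
    then obtain p where p: "p permutes {..<length xs}" "permute_list p xs = ys"
      using mset_eq_permutation by blast
    let ?q = "inv_into UNIV p"
    have "xs ! i = ys ! ?q i" if "i < n" for i
    proof -
      have "?q i < n"
        using p(1) that permutes_in_image[OF permutes_inv[OF p(1)]] n_def by auto
      then have "ys ! ?q i = xs ! p (?q i)"
        using p n_def by (auto simp: permute_list_nth)
      then show ?thesis
        using p(1) by (simp add: permutes_inverses)
    qed
    then show ?thesis
      using that[of ?q] permutes_inv[OF p(1)] n_def by simp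
  qed
  define B where "B = char_poly_matrix (adjacency_mat ys G)"
  have p0: "p permutes {0..<n}"
    using p by (simp add: atLeast0LessThan)
  have pl: "p i < n" if "i < n" for i
    using permutes_in_image[OF p] that by auto
  have p_inj: "p i = p j \<longleftrightarrow> i = j" for i j
    using permutes_inj[OF p] by (auto dest: injD)
  have B: "B \<in> carrier_mat n n"
    by (simp add: B_def adjacency_mat_def char_poly_matrix_def len)
  define R where "R = Matrix.mat n n (\<lambda>(i, j). B $$ (p i, j))"
  have R: "R \<in> carrier_mat n n" by (simp add: R_def)
  have A: "char_poly_matrix (adjacency_mat xs G) =
      transpose_mat (Matrix.mat n n (\<lambda>(i, j). transpose_mat R $$ (p i, j)))"
    by (rule eq_matI)
      (auto simp: R_def B_def char_poly_matrix_def adjacency_mat_def n_def[symmetric] len pl xs p_inj)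
  have "det (char_poly_matrix (adjacency_mat xs G)) =
      det (Matrix.mat n n (\<lambda>(i, j). transpose_mat R $$ (p i, j)))"
    unfolding A by (rule det_transpose[of _ n]) simp
  also have "\<dots> = signof p * det (transpose_mat R)"
    by (rule det_permute_rows[OF _ p0]) (use R in simp)
  also have "det (transpose_mat R) = det R"
    by (rule det_transpose[OF R])
  also have "det R = signof p * det B"
    unfolding R_def by (rule det_permute_rows[OF B p0])
  also have "signof p * (signof p * det B) = det B"
    by (simp add: sign_def)
  finally show ?thesis
    by (simp add: char_poly_def B_def)
qed

lemma graph_spectrum_eq:
  assumes "distinct xs" "set xs = pverts G"
  shows "graph_spectrum G = proots (char_poly (adjacency_mat xs G))"
proof -
  have "distinct (vertex_enum G) \<and> set (vertex_enum G) = pverts G"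
    unfolding vertex_enum_def by (rule someI[of _ xs]) (use assms in simp)
  then have "char_poly (adjacency_mat (vertex_enum G) G) = char_poly (adjacency_mat xs G)"
    using assms by (intro char_poly_adjacency_mat_cong) auto
  then show ?thesis by (simp add: graph_spectrum_def)
qed

end

theory Submission
  imports Defs "Jordan_Normal_Form.Schur_Decomposition"
begin

text \<open>
  An isolated vertex only contributes an eigenvalue \<open>0\<close>, so suppose there is none. Split the
  vertices of \<open>G\<close> into two nonempty parts with no edge between them. Each part contains an edge,
  hence has a positive eigenvalue, hence exactly one. It remains to see that a graph \<open>K\<close> without
  isolated vertices and with only one positive eigenvalue is complete multipartite, i.e. that
  non-adjacency is transitive. Otherwise there are an edge \<open>uv\<close> and a vertex \<open>w\<close> adjacent to neither
  \<open>u\<close> nor \<open>v\<close>, and \<open>w\<close> has a neighbour \<open>x\<close>; the adjacency form is then positive definite on the plane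
  spanned by \<open>e\<^sub>u + e\<^sub>v\<close> and \<open>e\<^sub>x + 2 e\<^sub>w\<close>, which forces two positive eigenvalues.

  Conversely, for a complete multipartite graph with \<open>m \<ge> 2\<close> parts the adjacency form is
  \<open>(\<Sum>\<^sub>v f v)\<^sup>2\<close> minus a sum of squares, hence nonpositive on a hyperplane, and its adjacency matrix
  factors through an invertible \<open>m \<times> m\<close> quotient matrix, which gives nullity \<open>n - m\<close>.
\<close>

section \<open>Diagonalization of real symmetric matrices\<close>

text \<open>By the fundamental theorem of algebra the complexified matrix has an eigenvalue
  \<open>k\<close> with an eigenvector \<open>w\<close>. Moving the matrix across the Hermitian
  product of \<open>w\<close> with itself gives \<open>k = cnj k\<close>, so \<open>k\<close> is a
  real root of the characteristic polynomial.\<close>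

lemma real_symmetric_eigenvalue:
  fixes A :: "real mat"
  assumes A: "A \<in> carrier_mat n n" and sym: "A\<^sup>T = A" and n: "n > 0"
  shows "\<exists>e. eigenvalue A e"
proof -
  let ?A = "map_mat complex_of_real A"
  have cA: "?A \<in> carrier_mat n n" using A by simp
  have "degree (char_poly ?A) = n"
    using degree_monic_char_poly[OF cA] by simp
  then have "\<not> constant (poly (char_poly ?A))"
    using n by (simp add: constant_degree)
  then obtain k where k: "poly (char_poly ?A) k = 0"
    using fundamental_theorem_of_algebra by blast
  then obtain w where w: "w \<in> carrier_vec n" "w \<noteq> 0\<^sub>v n" "?A *\<^sub>v w = k \<cdot>\<^sub>v w"
    using eigenvalue_root_char_poly[OF cA] cA
    unfolding eigenvalue_def eigenvector_def by auto
  have symA: "?A\<^sup>T = ?A"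
    using arg_cong[OF sym, of "map_mat complex_of_real"] by (simp add: map_mat_transpose)
  have conjA: "conjugate (?A *\<^sub>v w) = ?A *\<^sub>v conjugate w"
    using A w(1) by (intro eq_vecI) (auto simp: scalar_prod_def)
  have cw: "conjugate w \<in> carrier_vec n" using w by simp
  have "k * (w \<bullet>c w) = (?A *\<^sub>v w) \<bullet>c w"
    using w by simp
  also have "\<dots> = w \<bullet> (?A *\<^sub>v conjugate w)"
    using transpose_vec_mult_scalar[OF cA cw w(1)] symA by simp
  also have "\<dots> = w \<bullet> conjugate (k \<cdot>\<^sub>v w)"
    using conjA w by simp
  also have "\<dots> = cnj k * (w \<bullet>c w)"
    using w(1) by (simp add: conjugate_smult_vec)
  finally have "k = cnj k"
    using w by simp
  then obtain e where e: "k = complex_of_real e"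
    by (metis Reals_cnj_iff Reals_cases)
  have "complex_of_real (poly (char_poly A) e) = 0"
    using k unfolding e of_real_hom.char_poly_hom[OF A] by simp
  then have "poly (char_poly A) e = 0" by simp
  then show ?thesis
    using eigenvalue_root_char_poly[OF A] by blast
qed

text \<open>Gram-Schmidt applied to a basis that starts with \<open>v\<close> keeps this first
  vector, and normalizing only rescales it, whence the factor \<open>c\<close>. An eigenvector thus
  becomes the first column of an orthogonal matrix.\<close>

lemma orthonormal_completion:
  fixes v :: "real vec"
  assumes v: "v \<in> carrier_vec n" and v0: "v \<noteq> 0\<^sub>v n" and n: "n > 0"
  shows "\<exists>W c. W \<in> carrier_mat n n \<and> W\<^sup>T * W = 1\<^sub>m n \<and> col W 0 = c \<cdot>\<^sub>v v"
proof -
  interpret cof_vec_space n "TYPE(real)" .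
  define b where "b = basis_completion v"
  define ws where "ws = gram_schmidt n b"
  from basis_completion[OF v v0, folded b_def]
  have dist_b: "distinct b" and indep: "\<not> lin_dep (set b)"
    and b: "set b \<subseteq> carrier_vec n" and hdb: "hd b = v" and len_b: "length b = n"
    by auto
  from hdb len_b n obtain vs where bv: "b = v # vs" by (cases b, auto)
  from gram_schmidt_result[OF b dist_b indep refl, folded ws_def]
  have ws: "set ws \<subseteq> carrier_vec n" "corthogonal ws" "length ws = n"
    by (auto simp: len_b)
  from gram_schmidt_hd[OF v, of vs, folded bv] have hdws: "hd ws = v"
    unfolding ws_def .
  have wsc: "ws ! i \<in> carrier_vec n" if "i < n" for i
    using ws that by auto
  have orth: "ws ! i \<bullet> ws ! j = 0 \<longleftrightarrow> i \<noteq> j" if "i < n" "j < n" for i j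
    using corthogonalD[OF ws(2)] ws(3) that by simp
  have pos: "ws ! i \<bullet> ws ! i > 0" if "i < n" for i
    using orth[of i i] that conjugate_square_ge_0_vec[of "ws ! i"] by simp
  define us where "us = map (\<lambda>w. (1 / sqrt (w \<bullet> w)) \<cdot>\<^sub>v w) ws"
  define W where "W = mat_of_cols n us"
  have W: "W \<in> carrier_mat n n"
    using ws by (auto simp: W_def us_def)
  have colW: "col W i = (1 / sqrt (ws ! i \<bullet> ws ! i)) \<cdot>\<^sub>v (ws ! i)" if "i < n" for i
    unfolding W_def using that ws wsc by (subst col_mat_of_cols) (auto simp: us_def)
  have "W\<^sup>T * W = 1\<^sub>m n"
  proof (rule eq_matI)
    fix i j assume "i < dim_row (1\<^sub>m n :: real mat)" "j < dim_col (1\<^sub>m n :: real mat)"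
    then have ij: "i < n" "j < n" by auto
    then have "(W\<^sup>T * W) $$ (i, j) = col W i \<bullet> col W j"
      using W by simp
    also have "\<dots> = 1 / sqrt (ws ! i \<bullet> ws ! i) * (1 / sqrt (ws ! j \<bullet> ws ! j) * (ws ! i \<bullet> ws ! j))"
      using ij wsc[OF ij(1)] wsc[OF ij(2)] by (simp add: colW carrier_vecD)
    also have "\<dots> = (1\<^sub>m n :: real mat) $$ (i, j)"
      using ij orth[OF ij] pos[of i] by (auto simp: real_sqrt_mult_self)
    finally show "(W\<^sup>T * W) $$ (i, j) = (1\<^sub>m n) $$ (i, j)" .
  qed (use W in auto)
  moreover have "ws ! 0 = v"
    using hdws ws(3) n by (metis hd_conv_nth length_greater_0_conv)
  ultimately show ?thesis
    using W colW[OF n] by metis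
qed

text \<open>Deflation: in an orthonormal basis starting with an eigenvector the matrix splits into a
  1 x 1 block and a smaller symmetric block \<open>B\<close>, to which the induction hypothesis
  applies.\<close>

theorem real_symmetric_diagonalization:
  fixes A :: "real mat"
  assumes "A \<in> carrier_mat n n" and "A\<^sup>T = A"
  shows "\<exists>P d. P \<in> carrier_mat n n \<and> P\<^sup>T * P = 1\<^sub>m n \<and>
    P\<^sup>T * A * P = Matrix.mat n n (\<lambda>(i, j). if i = j then d i else 0)"
  using assms
proof (induction n arbitrary: A)
  case 0
  then show ?case
    by (intro exI[of _ A]) (auto intro!: eq_matI)
next
  case (Suc n A)
  note A = Suc.prems(1) and sym = Suc.prems(2)
  obtain e v where v: "v \<in> carrier_vec (Suc n)" "v \<noteq> 0\<^sub>v (Suc n)" and ev: "A *\<^sub>v v = e \<cdot>\<^sub>v v"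
    using real_symmetric_eigenvalue[OF A sym] A unfolding eigenvalue_def eigenvector_def by auto
  obtain W c where W: "W \<in> carrier_mat (Suc n) (Suc n)" and WW: "W\<^sup>T * W = 1\<^sub>m (Suc n)"
    and W0: "col W 0 = c \<cdot>\<^sub>v v"
    using orthonormal_completion[OF v] by auto
  define A' where "A' = W\<^sup>T * A * W"
  have A': "A' \<in> carrier_mat (Suc n) (Suc n)" using A W by (simp add: A'_def)
  have symA': "A'\<^sup>T = A'"
  proof -
    have "A'\<^sup>T = W\<^sup>T * (W\<^sup>T * A)\<^sup>T"
      unfolding A'_def by (rule transpose_mult) (use A W in auto)
    also have "(W\<^sup>T * A)\<^sup>T = A\<^sup>T * W\<^sup>T\<^sup>T"
      by (rule transpose_mult) (use A W in auto)
    finally show ?thesis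
      using A W sym by (simp add: A'_def assoc_mult_mat[of _ "Suc n" "Suc n"])
  qed
  have AW0: "A *\<^sub>v col W 0 = e \<cdot>\<^sub>v col W 0"
    using A v(1) ev by (simp add: W0 mult_mat_vec smult_smult_assoc mult.commute)
  \<comment> \<open>The first column of \<open>A'\<close> is \<open>W\<^sup>T\<close> applied to
    \<open>e\<close> times the first column of \<open>W\<close>, hence \<open>e\<close> times the
    first unit vector.\<close>
  have col0: "A' $$ (i, 0) = (if i = 0 then e else 0)" if i: "i < Suc n" for i
  proof -
    have "A' $$ (i, 0) = (W\<^sup>T * (A * W)) $$ (i, 0)"
      using A W by (simp add: A'_def assoc_mult_mat[of _ "Suc n" "Suc n"])
    also have "\<dots> = col W i \<bullet> col (A * W) 0"
      using A W i by simp
    also have "col (A * W) 0 = e \<cdot>\<^sub>v col W 0"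
      using A W unfolding AW0[symmetric] by (intro eq_vecI) auto
    also have "col W i \<bullet> (e \<cdot>\<^sub>v col W 0) = e * (W\<^sup>T * W) $$ (i, 0)"
      using W i by simp
    finally show ?thesis using i WW by simp
  qed
  have row0: "A' $$ (0, i) = (if i = 0 then e else 0)" if "i < Suc n" for i
    using col0[OF that] that A' symA' by (metis carrier_matD index_transpose_mat(1) zero_less_Suc)
  define B where "B = Matrix.mat n n (\<lambda>(i, j). A' $$ (Suc i, Suc j))"
  have B: "B \<in> carrier_mat n n" by (simp add: B_def)
  have "A' $$ (j, i) = A' $$ (i, j)" if "i < Suc n" "j < Suc n" for i j
    using that A' symA' by (metis carrier_matD index_transpose_mat(1))
  then have symB: "B\<^sup>T = B" by (intro eq_matI) (auto simp: B_def)
  obtain P d where P: "P \<in> carrier_mat n n" and PP: "P\<^sup>T * P = 1\<^sub>m n"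
    and PBP: "P\<^sup>T * B * P = Matrix.mat n n (\<lambda>(i, j). if i = j then d i else 0)"
    using Suc.IH[OF B symB] by blast
  let ?E = "Matrix.mat 1 1 (\<lambda>_. e)"
  have blockA: "A' = four_block_mat ?E (0\<^sub>m 1 n) (0\<^sub>m n 1) B"
    using A' B col0 row0 by (intro eq_matI) (auto simp: B_def)
  \<comment> \<open>\<open>P\<close> diagonalizes only \<open>B\<close>; bordered by 1 it leaves the
    split-off eigenvector alone, so that \<open>W * R\<close> diagonalizes \<open>A\<close>.\<close>
  define R where "R = four_block_mat (1\<^sub>m 1) (0\<^sub>m 1 n) (0\<^sub>m n 1) P"
  have R: "R \<in> carrier_mat (Suc n) (Suc n)"
    unfolding R_def using four_block_carrier_mat[OF _ P, of "1\<^sub>m 1" 1 1] by simp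
  have RT: "R\<^sup>T = four_block_mat (1\<^sub>m 1) (0\<^sub>m 1 n) (0\<^sub>m n 1) P\<^sup>T"
    unfolding R_def using P by (subst transpose_four_block_mat[of _ 1 1 _ n _ n]) auto
  have RR: "R\<^sup>T * R = 1\<^sub>m (Suc n)"
    unfolding RT unfolding R_def
    using P PP by (subst mult_four_block_mat[of _ 1 1 _ n _ n _ _ 1 _ n]) auto
  have RAR: "R\<^sup>T * A' * R = four_block_mat ?E (0\<^sub>m 1 n) (0\<^sub>m n 1) (P\<^sup>T * B * P)"
  proof -
    have "R\<^sup>T * A' = four_block_mat ?E (0\<^sub>m 1 n) (0\<^sub>m n 1) (P\<^sup>T * B)"
      unfolding RT blockA using P B by (subst mult_four_block_mat[of _ 1 1 _ n _ n _ _ 1 _ n]) auto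
    then show ?thesis
      unfolding R_def using P B by (simp, subst mult_four_block_mat[of _ 1 1 _ n _ n _ _ 1 _ n]) auto
  qed
  define Z where "Z = W * R"
  have Z: "Z \<in> carrier_mat (Suc n) (Suc n)" using W R by (simp add: Z_def)
  have ZT: "Z\<^sup>T = R\<^sup>T * W\<^sup>T" using W R by (simp add: Z_def transpose_mult)
  note assoc = assoc_mult_mat[of _ "Suc n" "Suc n" _ "Suc n" _ "Suc n"]
  have "Z\<^sup>T * Z = (R\<^sup>T * W\<^sup>T) * (W * R)"
    unfolding ZT by (simp only: Z_def)
  also have "\<dots> = R\<^sup>T * ((W\<^sup>T * W) * R)"
    using W R by (simp add: assoc)
  finally have ZZ: "Z\<^sup>T * Z = 1\<^sub>m (Suc n)"
    using R RR by (simp add: WW)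
  have "Z\<^sup>T * A * Z = (R\<^sup>T * W\<^sup>T) * A * (W * R)"
    unfolding ZT by (simp only: Z_def)
  also have "\<dots> = R\<^sup>T * A' * R"
    using W R A by (simp add: A'_def assoc)
  also have "\<dots> = Matrix.mat (Suc n) (Suc n)
      (\<lambda>(i, j). if i = j then (case i of 0 \<Rightarrow> e | Suc k \<Rightarrow> d k) else 0)"
    unfolding RAR PBP by (intro eq_matI) (auto split: nat.splits)
  finally show ?case
    using Z ZZ by blast
qed

section \<open>Positive eigenvalues and the quadratic form\<close>

text \<open>Vectors are functions, of which only the values below \<open>n\<close> matter, so linear
  combinations need no carrier conditions.\<close>

definition quad_form :: "nat \<Rightarrow> real mat \<Rightarrow> (nat \<Rightarrow> real) \<Rightarrow> real" where
  "quad_form n A x = (\<Sum>i<n. \<Sum>j<n. A $$ (i, j) * x i * x j)"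

text \<open>The spectral theorem in coordinates, with \<open>p k\<close> the \<open>k\<close>-th
  column of the orthogonal matrix. The weights \<open>d k\<close> of the squares are the roots with
  multiplicity, so signs of the form translate into signs of roots.\<close>

lemma real_symmetric_spectral_form:
  fixes A :: "real mat"
  assumes A: "A \<in> carrier_mat n n" and sym: "A\<^sup>T = A"
  obtains p :: "nat \<Rightarrow> nat \<Rightarrow> real" and d :: "nat \<Rightarrow> real" where
    "proots (char_poly A) = image_mset d (mset_set {..<n})"
    "\<And>x. quad_form n A x = (\<Sum>k<n. d k * (\<Sum>i<n. p k i * x i)\<^sup>2)"
    "\<And>k l. k < n \<Longrightarrow> l < n \<Longrightarrow> (\<Sum>i<n. p k i * p l i) = (if k = l then 1 else 0)"
proof -
  obtain P d where P: "P \<in> carrier_mat n n" and PP: "P\<^sup>T * P = 1\<^sub>m n"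
    and D: "P\<^sup>T * A * P = Matrix.mat n n (\<lambda>(i, j). if i = j then d i else 0)" (is "_ = ?D")
    using real_symmetric_diagonalization[OF A sym] by blast
  have PT: "P\<^sup>T \<in> carrier_mat n n" using P by simp
  have PPT: "P * P\<^sup>T = 1\<^sub>m n" using mat_mult_left_right_inverse[OF PT P PP] .
  have "P * (P\<^sup>T * A * P) * P\<^sup>T = (P * P\<^sup>T) * A * (P * P\<^sup>T)"
    using A P by (simp add: assoc_mult_mat[of _ n n _ n _ n])
  then have AD: "A = P * ?D * P\<^sup>T"
    using A by (simp add: D PPT)
  have Dc: "?D \<in> carrier_mat n n" by simp
  have "similar_mat A ?D"
    by (rule similar_matI[of _ _ P "P\<^sup>T" n]) (use A P PP PPT AD in auto)
  then have "char_poly A = char_poly ?D" by (rule char_poly_similar)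
  also have "\<dots> = (\<Prod>a\<leftarrow>diag_mat ?D. [:- a, 1:])"
    by (rule char_poly_upper_triangular[OF Dc]) auto
  also have "diag_mat ?D = map d [0..<n]"
    by (auto simp: diag_mat_def)
  also have "(\<Prod>a\<leftarrow>map d [0..<n]. [:- a, 1:]) = (\<Prod>k<n. [:- d k, 1:])"
    by (simp add: interv_sum_list_conv_sum_set_nat prod.list_conv_set_nth o_def atLeast0LessThan)
  finally have "proots (char_poly A) = (\<Sum>k<n. proots [:- d k, 1:])"
    by (simp add: proots_prod)
  also have "\<dots> = image_mset d (mset_set {..<n})"
    by (induction n) (simp_all add: lessThan_Suc)
  finally have 1: "proots (char_poly A) = image_mset d (mset_set {..<n})" .
  define p where "p = (\<lambda>k i. P $$ (i, k))"
  have Aij: "A $$ (i, j) = (\<Sum>k<n. p k i * d k * p k j)" if "i < n" "j < n" for i j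
  proof -
    have "(P * ?D) $$ (i, k) = p k i * d k" if "k < n" for k
      using P \<open>i < n\<close> that by (simp add: scalar_prod_def p_def if_distrib cong: if_cong)
    then show ?thesis
      using P that by (subst AD) (simp add: scalar_prod_def p_def atLeast0LessThan)
  qed
  have 2: "quad_form n A x = (\<Sum>k<n. d k * (\<Sum>i<n. p k i * x i)\<^sup>2)" for x
  proof -
    have "quad_form n A x = (\<Sum>i<n. \<Sum>j<n. \<Sum>k<n. d k * ((p k i * x i) * (p k j * x j)))"
      by (simp add: quad_form_def Aij sum_distrib_left sum_distrib_right mult_ac)
    also have "\<dots> = (\<Sum>i<n. \<Sum>k<n. \<Sum>j<n. d k * ((p k i * x i) * (p k j * x j)))"
      by (intro sum.cong refl sum.swap)
    also have "\<dots> = (\<Sum>k<n. \<Sum>i<n. \<Sum>j<n. d k * ((p k i * x i) * (p k j * x j)))"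
      by (rule sum.swap)
    also have "\<dots> = (\<Sum>k<n. d k * (\<Sum>i<n. p k i * x i)\<^sup>2)"
      proof (intro sum.cong refl)
      fix k
      have "(\<Sum>i<n. p k i * x i)\<^sup>2 = (\<Sum>i<n. \<Sum>j<n. (p k i * x i) * (p k j * x j))"
        by (simp only: power2_eq_square sum_product)
      then show "(\<Sum>i<n. \<Sum>j<n. d k * ((p k i * x i) * (p k j * x j))) =
          d k * (\<Sum>i<n. p k i * x i)\<^sup>2"
        by (simp only: sum_distrib_left)
    qed
    finally show ?thesis .
  qed
  have 3: "(\<Sum>i<n. p k i * p l i) = (if k = l then 1 else 0)" if "k < n" "l < n" for k l
  proof -
    have "(P\<^sup>T * P) $$ (k, l) = (\<Sum>i<n. p k i * p l i)"
      using P that by (simp add: scalar_prod_def p_def atLeast0LessThan)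
    then show ?thesis using PP that by simp
  qed
  show ?thesis using that 1 2 3 by blast
qed

lemma size_filter_image_mset_set:
  assumes "finite S"
  shows "size {#x \<in># image_mset d (mset_set S). P x#} = card {k \<in> S. P (d k)}"
  using assms by (simp add: filter_mset_image_mset)

lemma num_pos_roots_ge_1:
  fixes A :: "real mat"
  assumes "A \<in> carrier_mat n n" "A\<^sup>T = A" and pos: "quad_form n A x > 0"
  shows "size {#e \<in># proots (char_poly A). e > 0#} \<ge> 1"
proof -
  obtain p d where roots: "proots (char_poly A) = image_mset d (mset_set {..<n})"
    and Q: "\<And>x. quad_form n A x = (\<Sum>k<n. d k * (\<Sum>i<n. p k i * x i)\<^sup>2)"
    by (rule real_symmetric_spectral_form[OF assms(1,2)]) blast
  have "\<exists>k<n. d k > 0"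
  proof (rule ccontr)
    assume "\<not> ?thesis"
    then have "quad_form n A x \<le> 0"
      unfolding Q by (intro sum_nonpos mult_nonpos_nonneg) auto
    then show False using pos by simp
  qed
  then show ?thesis
    by (auto simp: roots size_filter_image_mset_set Suc_le_eq card_gt_0_iff)
qed

text \<open>If at most one \<open>d k\<close> is positive, a single linear condition on
  \<open>(a, b)\<close> makes its square vanish, and the form is nonpositive at a nontrivial
  combination. Positivity for all nonzero \<open>(a, b)\<close> also encodes that \<open>x\<close>
  and \<open>y\<close> are independent.\<close>

lemma num_pos_roots_ge_2:
  fixes A :: "real mat"
  assumes "A \<in> carrier_mat n n" "A\<^sup>T = A"
    and pos: "\<And>a b. (a, b) \<noteq> (0, 0) \<Longrightarrow> quad_form n A (\<lambda>i. a * x i + b * y i) > 0"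
  shows "size {#e \<in># proots (char_poly A). e > 0#} \<ge> 2"
proof (rule ccontr)
  obtain p d where roots: "proots (char_poly A) = image_mset d (mset_set {..<n})"
    and Q: "\<And>x. quad_form n A x = (\<Sum>k<n. d k * (\<Sum>i<n. p k i * x i)\<^sup>2)"
    by (rule real_symmetric_spectral_form[OF assms(1,2)]) blast
  assume "\<not> ?thesis"
  then have "card {k \<in> {..<n}. d k > 0} \<le> Suc 0"
    by (simp add: roots size_filter_image_mset_set)
  then have le1: "\<And>k l. k < n \<Longrightarrow> l < n \<Longrightarrow> d k > 0 \<Longrightarrow> d l > 0 \<Longrightarrow> k = l"
    by (subst (asm) card_le_Suc0_iff_eq) auto
  \<comment> \<open>\<open>m\<close> is the only index with a positive weight, or arbitrary if there
    is none.\<close>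
  obtain m where m: "\<And>k. k < n \<Longrightarrow> k \<noteq> m \<Longrightarrow> d k \<le> 0"
    using le1 by (metis not_le)
  define u v where "u = (\<Sum>i<n. p m i * x i)" and "v = (\<Sum>i<n. p m i * y i)"
  obtain a b where ab: "(a, b) \<noteq> (0, 0)" "a * u + b * v = 0"
  proof (cases "u = 0 \<and> v = 0")
    case True
    then show ?thesis using that[of 1 0] by simp
  next
    case False
    then show ?thesis using that[of v "- u"] by auto
  qed
  have "(\<Sum>i<n. p m i * (a * x i + b * y i)) = a * u + b * v"
    by (simp add: u_def v_def sum_distrib_left sum.distrib algebra_simps)
  then have "d k * (\<Sum>i<n. p k i * (a * x i + b * y i))\<^sup>2 \<le> 0" if "k < n" for k
    using m[OF that] ab(2) by (cases "k = m") (auto intro: mult_nonpos_nonneg)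
  then have "quad_form n A (\<lambda>i. a * x i + b * y i) \<le> 0"
    unfolding Q by (intro sum_nonpos) auto
  then show False using pos[OF ab(1)] by simp
qed

text \<open>Two orthonormal eigenvectors with positive eigenvalues span a plane on which the form is
  positive definite. The plane contains a nonzero vector orthogonal to \<open>u\<close>.\<close>

lemma num_pos_roots_le_1:
  fixes A :: "real mat"
  assumes "A \<in> carrier_mat n n" "A\<^sup>T = A"
    and neg: "\<And>x. (\<Sum>i<n. u i * x i) = 0 \<Longrightarrow> quad_form n A x \<le> 0"
  shows "size {#e \<in># proots (char_poly A). e > 0#} \<le> 1"
proof (rule ccontr)
  obtain p d where roots: "proots (char_poly A) = image_mset d (mset_set {..<n})"
    and Q: "\<And>x. quad_form n A x = (\<Sum>k<n. d k * (\<Sum>i<n. p k i * x i)\<^sup>2)"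
    and orth: "\<And>k l. k < n \<Longrightarrow> l < n \<Longrightarrow> (\<Sum>i<n. p k i * p l i) = (if k = l then 1 else 0)"
    by (rule real_symmetric_spectral_form[OF assms(1,2)]) blast
  assume "\<not> ?thesis"
  then have "\<not> card {k \<in> {..<n}. d k > 0} \<le> Suc 0"
    by (simp add: roots size_filter_image_mset_set)
  then obtain k l where kl: "k < n" "l < n" "d k > 0" "d l > 0" "k \<noteq> l"
    by (subst (asm) card_le_Suc0_iff_eq) auto
  define s t where "s = (\<Sum>i<n. u i * p k i)" and "t = (\<Sum>i<n. u i * p l i)"
  obtain a b where ab: "a \<noteq> 0 \<or> b \<noteq> 0" "a * s + b * t = 0"
  proof (cases "s = 0 \<and> t = 0")
    case True
    then show ?thesis using that[of 1 0] by simp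
  next
    case False
    then show ?thesis using that[of t "- s"] by auto
  qed
  let ?x = "\<lambda>i. a * p k i + b * p l i"
  have "(\<Sum>i<n. u i * ?x i) = a * s + b * t"
    by (simp add: s_def t_def sum_distrib_left sum.distrib algebra_simps)
  then have "quad_form n A ?x \<le> 0" using neg ab(2) by simp
  have "(\<Sum>i<n. p m i * ?x i) = a * (\<Sum>i<n. p m i * p k i) + b * (\<Sum>i<n. p m i * p l i)" for m
    by (simp add: sum_distrib_left sum.distrib algebra_simps)
  \<comment> \<open>By orthonormality the combination has coordinates \<open>a\<close> at
    \<open>k\<close>, \<open>b\<close> at \<open>l\<close> and 0 elsewhere, so only two squares
    survive in the form.\<close>
  then have coord: "(\<Sum>i<n. p m i * ?x i) = (if m = k then a else 0) + (if m = l then b else 0)"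
    if "m < n" for m
    using that kl by (simp add: orth)
  have "quad_form n A ?x = (\<Sum>m<n. (if m = k then d m * a\<^sup>2 else 0) + (if m = l then d m * b\<^sup>2 else 0))"
    unfolding Q using coord kl(5) by (intro sum.cong) auto
  also have "\<dots> = d k * a\<^sup>2 + d l * b\<^sup>2"
    using kl by (simp add: sum.distrib)
  also have "\<dots> > 0"
    using kl ab(1) by (auto intro: add_pos_nonneg add_nonneg_pos)
  finally show False using \<open>quad_form n A ?x \<le> 0\<close> by simp
qed

text \<open>
  The Schur complements of the two diagonal blocks of \<open>?M\<close> below have determinants \<open>det (x - S * C)\<close>
  and \<open>det (x - C * S)\<close>, up to powers of \<open>x\<close>.
\<close>

lemma char_poly_mult_commute:
  fixes S C :: "real mat"
  assumes S: "S \<in> carrier_mat n m" and C: "C \<in> carrier_mat m n"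
  shows "monom 1 m * char_poly (S * C) = monom 1 n * char_poly (C * S)"
proof -
  let ?X = "[:0, 1:] :: real poly"
  let ?c = "map_mat (\<lambda>a. [:a:]) :: real mat \<Rightarrow> real poly mat"
  define S' C' where "S' = ?c S" and "C' = ?c C"
  have S': "S' \<in> carrier_mat n m" and C': "C' \<in> carrier_mat m n"
    using S C by (auto simp: S'_def C'_def)
  have hom: "S' * C' = ?c (S * C)" "C' * S' = ?c (C * S)"
    using map_poly_mult(1)[OF S C] map_poly_mult(1)[OF C S] by (simp_all add: S'_def C'_def)
  have X: "det (?X \<cdot>\<^sub>m 1\<^sub>m k) = monom 1 k" for k
    by (simp add: monom_altdef)
  let ?M = "four_block_mat (?X \<cdot>\<^sub>m 1\<^sub>m n) S' C' (1\<^sub>m m)"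
  \<comment> \<open>Multiplying \<open>?M\<close> by \<open>?L\<close> from the right or by
    \<open>?R\<close> from the left clears its lower left block. The factor \<open>?X\<close> in the
    corner of \<open>?R\<close> avoids a division by the indeterminate and produces
    \<open>monom 1 m\<close>.\<close>
  let ?L = "four_block_mat (1\<^sub>m n) (0\<^sub>m n m) (- C') (1\<^sub>m m)"
  let ?R = "four_block_mat (1\<^sub>m n) (0\<^sub>m n m) (- C') (?X \<cdot>\<^sub>m 1\<^sub>m m)"
  have M: "?M \<in> carrier_mat (n + m) (n + m)" by simp
  have cp: "char_poly B = det (?X \<cdot>\<^sub>m 1\<^sub>m k + - ?c B)" if "B \<in> carrier_mat k k" for B k
  proof -
    have "map_mat (\<lambda>a. [:- a:]) B = - ?c B" by (intro eq_matI) auto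
    then show ?thesis using that by (simp add: char_poly_defs)
  qed
  have 1: "?M * ?L = four_block_mat (?X \<cdot>\<^sub>m 1\<^sub>m n + - (S' * C')) S' (0\<^sub>m m n) (1\<^sub>m m)"
    using S' C' by (subst mult_four_block_mat[of _ n n _ m _ m _ _ n _ m])
      (auto intro!: cong_four_block_mat)
  have "det ?M * det ?L = det (?M * ?L)"
    by (rule det_mult[symmetric, of _ "n + m"]) (use S' C' in auto)
  also have "det ?L = 1"
    by (subst det_four_block_mat_upper_right_zero[of _ n _ m]) (use C' in auto)
  also have "det (?M * ?L) = char_poly (S * C)"
    unfolding 1 by (subst det_four_block_mat_lower_left_zero[of _ n _ m]) (use S C S' C' in \<open>auto simp: hom cp[of _ n]\<close>)
  finally have detM: "det ?M = char_poly (S * C)" by simp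
  have 2: "?R * ?M = four_block_mat (?X \<cdot>\<^sub>m 1\<^sub>m n) S' (0\<^sub>m m n) (?X \<cdot>\<^sub>m 1\<^sub>m m + - (C' * S'))"
    using S' C' by (subst mult_four_block_mat[of _ n n _ m _ m _ _ n _ m])
      (auto intro!: cong_four_block_mat)
  have "det ?R * det ?M = det (?R * ?M)"
    by (rule det_mult[symmetric, of _ "n + m"]) (use S' C' in auto)
  also have "det ?R = monom 1 m"
    by (subst det_four_block_mat_upper_right_zero[of _ n _ m]) (use C' X in auto)
  also have "det (?R * ?M) = monom 1 n * char_poly (C * S)"
    unfolding 2 by (subst det_four_block_mat_lower_left_zero[of _ n _ m]) (use S C S' C' X in \<open>auto simp: hom cp[of _ m]\<close>)
  finally show ?thesis by (simp add: detM)
qed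

section \<open>Eigenvalues of graphs\<close>

text \<open>The quadratic form of the adjacency matrix, indexed by vertices and thus free of an
  enumeration. In an undirected graph each edge is counted in both directions.\<close>

definition adj_form :: "'a pair_pre_digraph \<Rightarrow> ('a \<Rightarrow> real) \<Rightarrow> real" where
  "adj_form G f = (\<Sum>u\<in>pverts G. \<Sum>v\<in>pverts G. if (u, v) \<in> parcs G then f u * f v else 0)"

text \<open>Turns the form of a test function with small support into a sum over a few explicit
  vertices.\<close>

lemma adj_form_restrict:
  assumes "finite (pverts G)" "S \<subseteq> pverts G" "\<And>v. v \<notin> S \<Longrightarrow> f v = 0"
  shows "adj_form G f = (\<Sum>u\<in>S. \<Sum>v\<in>S. if (u, v) \<in> parcs G then f u * f v else 0)"
proof -
  have "(\<Sum>v\<in>pverts G. if (u, v) \<in> parcs G then f u * f v else 0) =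
      (\<Sum>v\<in>S. if (u, v) \<in> parcs G then f u * f v else 0)" for u
    using assms by (intro sum.mono_neutral_right) auto
  then have "adj_form G f = (\<Sum>u\<in>pverts G. \<Sum>v\<in>S. if (u, v) \<in> parcs G then f u * f v else 0)"
    by (simp add: adj_form_def)
  also have "\<dots> = (\<Sum>u\<in>S. \<Sum>v\<in>S. if (u, v) \<in> parcs G then f u * f v else 0)"
    using assms by (intro sum.mono_neutral_right) (auto intro!: sum.neutral)
  finally show ?thesis .
qed

lemma adjacency_mat_carrier [simp]: "adjacency_mat xs G \<in> carrier_mat (length xs) (length xs)"
  by (simp add: adjacency_mat_def)

lemma pair_graph_arc_sym: "pair_graph G \<Longrightarrow> (u, v) \<in> parcs G \<Longrightarrow> (v, u) \<in> parcs G"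
  using pair_sym_digraph.pair_sym_arcs[of G]
  by (auto simp: pair_graph_def pair_pseudo_graph_def symmetric_def sym_def)

lemma pair_graph_irrefl: "pair_graph G \<Longrightarrow> (u, u) \<notin> parcs G"
  using pair_loopfree_digraph.pair_no_loops[of G "(u, u)"]
  by (auto simp: pair_graph_def pair_digraph_def)

lemma pair_graph_arc_verts:
  assumes "pair_graph G" "(u, v) \<in> parcs G"
  shows "u \<in> pverts G" "v \<in> pverts G"
proof -
  interpret pair_graph G by fact
  show "u \<in> pverts G" "v \<in> pverts G"
    using assms(2) by (auto dest: in_arcsD1 in_arcsD2)
qed

lemma pair_graph_finite_verts: "pair_graph G \<Longrightarrow> finite (pverts G)"
  using pair_fin_digraph.pair_finite_verts[of G]
  by (simp add: pair_graph_def pair_digraph_def)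

lemma pair_graph_wf: "pair_graph G \<Longrightarrow> pair_wf_digraph G"
  by (simp add: pair_graph_def pair_digraph_def pair_fin_digraph_def)

lemma pair_graphI:
  assumes "finite (pverts G)" "parcs G \<subseteq> pverts G \<times> pverts G"
    "\<And>u v. (u, v) \<in> parcs G \<Longrightarrow> (v, u) \<in> parcs G" "\<And>u. (u, u) \<notin> parcs G"
  shows "pair_graph G"
proof -
  have "finite (parcs G)"
    using assms by (meson finite_SigmaI finite_subset)
  then show ?thesis
    using assms by unfold_locales (auto simp: symmetric_def sym_def)
qed

lemma adjacency_mat_sym:
  assumes "pair_graph G"
  shows "(adjacency_mat xs G)\<^sup>T = adjacency_mat xs G"
  by (rule eq_matI) (auto simp: adjacency_mat_def dest: pair_graph_arc_sym[OF assms])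

lemma quad_form_adjacency_mat:
  assumes "distinct xs" "set xs = pverts G"
  shows "quad_form (length xs) (adjacency_mat xs G) (\<lambda>i. f (xs ! i)) = adj_form G f"
proof -
  have bij: "bij_betw ((!) xs) {..<length xs} (pverts G)"
    using assms by (intro bij_betw_nth) auto
  have "quad_form (length xs) (adjacency_mat xs G) (\<lambda>i. f (xs ! i)) =
      (\<Sum>i<length xs. \<Sum>j<length xs.
        if (xs ! i, xs ! j) \<in> parcs G then f (xs ! i) * f (xs ! j) else 0)"
    unfolding quad_form_def by (intro sum.cong) (auto simp: adjacency_mat_def)
  also have "\<dots> = (\<Sum>i<length xs. \<Sum>v\<in>pverts G.
        if (xs ! i, v) \<in> parcs G then f (xs ! i) * f v else 0)"
    by (intro sum.cong refl sum.reindex_bij_betw[OF bij])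
  also have "\<dots> = adj_form G f"
    unfolding adj_form_def
    by (rule sum.reindex_bij_betw[OF bij, of "\<lambda>u. \<Sum>v\<in>pverts G. if (u, v) \<in> parcs G then f u * f v else 0"])
  finally show ?thesis .
qed

section \<open>Positive eigenvalues from the sign of the adjacency form\<close>

lemma num_pos_eigenvalues_ge_1:
  assumes G: "pair_graph G" and pos: "adj_form G f > 0"
  shows "num_pos_eigenvalues G \<ge> 1"
proof -
  obtain xs where xs: "distinct xs" "set xs = pverts G"
    using finite_distinct_list[OF pair_graph_finite_verts[OF G]] by blast
  show ?thesis
    unfolding num_pos_eigenvalues_def graph_spectrum_eq[OF xs]
    by (rule num_pos_roots_ge_1[OF adjacency_mat_carrier adjacency_mat_sym[OF G], of _ "\<lambda>i. f (xs ! i)"])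
      (simp add: pos quad_form_adjacency_mat[OF xs])
qed

lemma num_pos_eigenvalues_ge_2:
  assumes G: "pair_graph G"
    and pos: "\<And>a b. (a, b) \<noteq> (0, 0) \<Longrightarrow> adj_form G (\<lambda>v. a * f v + b * g v) > 0"
  shows "num_pos_eigenvalues G \<ge> 2"
proof -
  obtain xs where xs: "distinct xs" "set xs = pverts G"
    using finite_distinct_list[OF pair_graph_finite_verts[OF G]] by blast
  show ?thesis
    unfolding num_pos_eigenvalues_def graph_spectrum_eq[OF xs]
    by (rule num_pos_roots_ge_2[OF adjacency_mat_carrier adjacency_mat_sym[OF G],
          of _ "\<lambda>i. f (xs ! i)" "\<lambda>i. g (xs ! i)"])
      (use pos quad_form_adjacency_mat[OF xs, of "\<lambda>v. _ * f v + _ * g v"] in simp)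
qed

lemma num_pos_eigenvalues_le_1:
  assumes G: "pair_graph G"
    and neg: "\<And>f. (\<Sum>v\<in>pverts G. h v * f v) = 0 \<Longrightarrow> adj_form G f \<le> 0"
  shows "num_pos_eigenvalues G \<le> 1"
proof -
  obtain xs where xs: "distinct xs" "set xs = pverts G"
    using finite_distinct_list[OF pair_graph_finite_verts[OF G]] by blast
  have bij: "bij_betw ((!) xs) {..<length xs} (pverts G)"
    using xs by (intro bij_betw_nth) auto
  have "quad_form (length xs) (adjacency_mat xs G) x \<le> 0"
    if x: "(\<Sum>i<length xs. h (xs ! i) * x i) = 0" for x
  proof -
    \<comment> \<open>\<open>f\<close> is the function on vertices whose coordinates in the
      enumeration \<open>xs\<close> are those of \<open>x\<close>.\<close>
    define f where "f v = x (inv_into {..<length xs} ((!) xs) v)" for v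
    have f: "f (xs ! i) = x i" if "i < length xs" for i
      using that bij by (simp add: f_def bij_betw_inv_into_left)
    have "(\<Sum>v\<in>pverts G. h v * f v) = (\<Sum>i<length xs. h (xs ! i) * f (xs ! i))"
      by (rule sum.reindex_bij_betw[OF bij, symmetric])
    also have "\<dots> = 0" using x by (simp add: f)
    finally have "adj_form G f \<le> 0" by (rule neg)
    moreover have "quad_form (length xs) (adjacency_mat xs G) x =
        quad_form (length xs) (adjacency_mat xs G) (\<lambda>i. f (xs ! i))"
      unfolding quad_form_def by (intro sum.cong refl) (simp add: f)
    ultimately show ?thesis
      using quad_form_adjacency_mat[OF xs, of f] by simp
  qed
  then show ?thesis
    unfolding num_pos_eigenvalues_def graph_spectrum_eq[OF xs]
    by (intro num_pos_roots_le_1[OF adjacency_mat_carrier adjacency_mat_sym[OF G]])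
qed

text \<open>The indicator function of the two ends of an edge has form value 2.\<close>

lemma num_pos_eigenvalues_ge_1_arc:
  assumes G: "pair_graph G" and uv: "(u, v) \<in> parcs G"
  shows "num_pos_eigenvalues G \<ge> 1"
proof -
  let ?f = "\<lambda>x. if x = u \<or> x = v then 1 else 0 :: real"
  have "u \<noteq> v" using uv pair_graph_irrefl[OF G] by auto
  have "adj_form G ?f =
      (\<Sum>x\<in>{u, v}. \<Sum>y\<in>{u, v}. if (x, y) \<in> parcs G then ?f x * ?f y else 0)"
    using pair_graph_finite_verts[OF G] pair_graph_arc_verts[OF G uv]
    by (intro adj_form_restrict) auto
  also have "\<dots> = 2"
    using \<open>u \<noteq> v\<close> uv pair_graph_arc_sym[OF G uv] pair_graph_irrefl[OF G] by simp
  finally show ?thesis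
    by (intro num_pos_eigenvalues_ge_1[OF G, of ?f]) simp
qed

text \<open>Since \<open>w\<close> is adjacent to neither end of the edge \<open>uv\<close>, the
  only undetermined adjacencies among the four vertices are those of \<open>x\<close> with
  \<open>u\<close> and \<open>v\<close>. The form is positive definite on the span of two test
  functions in each of these cases.\<close>

lemma num_pos_eigenvalues_ge_2_arcs:
  assumes G: "pair_graph G" and uv: "(u, v) \<in> parcs G" and wx: "(w, x) \<in> parcs G"
    and "(u, w) \<notin> parcs G" "(v, w) \<notin> parcs G"
  shows "num_pos_eigenvalues G \<ge> 2"
proof (rule num_pos_eigenvalues_ge_2[OF G])
  let ?f = "\<lambda>z. if z = u \<or> z = v then 1 else 0 :: real"
  \<comment> \<open>The weight 2 at \<open>w\<close> matters: with weight 1 and \<open>x\<close>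
    adjacent to both \<open>u\<close> and \<open>v\<close>, the form would be
    \<open>2 * (a + b)\<^sup>2\<close>, which degenerates at \<open>b = - a\<close>.\<close>
  let ?g = "\<lambda>z. if z = x then 1 else if z = w then 2 else 0 :: real"
  fix a b :: real assume ab: "(a, b) \<noteq> (0, 0)"
  let ?h = "\<lambda>z. a * ?f z + b * ?g z"
  note sym = pair_graph_arc_sym[OF G]
  \<comment> \<open>\<open>x\<close> differs from \<open>u\<close> and \<open>v\<close> because it
    is a neighbour of \<open>w\<close> and they are not.\<close>
  have ne: "u \<noteq> v" "w \<noteq> x" "u \<noteq> w" "v \<noteq> w" "u \<noteq> x" "v \<noteq> x"
    using assms pair_graph_irrefl[OF G] sym by blast+
  have nadj: "(w, u) \<notin> parcs G" "(w, v) \<notin> parcs G"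
    using assms sym by blast+
  have symx: "(x, u) \<in> parcs G \<longleftrightarrow> (u, x) \<in> parcs G" "(x, v) \<in> parcs G \<longleftrightarrow> (v, x) \<in> parcs G"
    using sym by blast+
  define k where "k = (if (u, x) \<in> parcs G then 1 else 0) + (if (v, x) \<in> parcs G then 1 else 0 :: real)"
  have "adj_form G ?h =
      (\<Sum>y\<in>{u, v, w, x}. \<Sum>z\<in>{u, v, w, x}. if (y, z) \<in> parcs G then ?h y * ?h z else 0)"
    using pair_graph_finite_verts[OF G] pair_graph_arc_verts[OF G uv] pair_graph_arc_verts[OF G wx]
    by (intro adj_form_restrict) auto
  also have "\<dots> = 2 * a\<^sup>2 + 4 * b\<^sup>2 + 2 * a * b * k"
    using ne uv wx assms(4,5) nadj sym[OF uv] sym[OF wx] pair_graph_irrefl[OF G]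
    by (simp add: symx k_def power2_eq_square algebra_simps)
  \<comment> \<open>As \<open>k\<close> counts the neighbours of \<open>x\<close> among
    \<open>u\<close> and \<open>v\<close>, it lies between 0 and 2, and every summand of this
    decomposition is nonnegative.\<close>
  also have "\<dots> = (2 - k) * (a\<^sup>2 + b\<^sup>2) + k * (a + b)\<^sup>2 + 2 * b\<^sup>2"
    by (simp add: power2_eq_square algebra_simps)
  also have "\<dots> > 0"
  proof (cases "b = 0")
    case True
    then have "a \<noteq> 0" using ab by simp
    then have "(2 - k) * a\<^sup>2 + k * a\<^sup>2 > 0" by (simp add: algebra_simps)
    then show ?thesis using True by simp
  next
    case False
    have "0 \<le> k" "k \<le> 2" by (auto simp: k_def)
    then show ?thesis using False by (intro add_nonneg_pos add_nonneg_nonneg) auto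
  qed
  finally show "adj_form G ?h > 0" .
qed

section \<open>Spectrum of complete multipartite graphs\<close>

text \<open>\<open>part\<close> maps onto \<open>{..<m}\<close>, so all \<open>m\<close> parts are
  nonempty. The form is the square of the total minus the squares of the part sums, hence
  nonpositive wherever the total vanishes; two parts yield an edge and so a positive
  eigenvalue.\<close>

lemma multipartite_num_pos_eigenvalues:
  fixes part :: "'a \<Rightarrow> nat"
  assumes G: "pair_graph G"
    and arcs: "parcs G = {(u, v). u \<in> pverts G \<and> v \<in> pverts G \<and> part u \<noteq> part v}"
    and part: "part ` pverts G = {..<m}" and m: "m \<ge> 2"
  shows "num_pos_eigenvalues G = 1"
proof (rule antisym)
  have fin: "finite (pverts G)" by (rule pair_graph_finite_verts[OF G])
  have "adj_form G f = (\<Sum>v\<in>pverts G. f v)\<^sup>2 - (\<Sum>k<m. (\<Sum>v\<in>pverts G. if part v = k then f v else 0)\<^sup>2)" for f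
  proof -
    let ?V = "pverts G"
    have "(\<Sum>k<m. (\<Sum>v\<in>?V. if part v = k then f v else 0)\<^sup>2) =
        (\<Sum>k<m. \<Sum>u\<in>?V. \<Sum>v\<in>?V. if part u = k \<and> part v = k then f u * f v else 0)"
      unfolding power2_eq_square sum_product by (intro sum.cong) auto
    also have "\<dots> = (\<Sum>u\<in>?V. \<Sum>k<m. \<Sum>v\<in>?V. if part u = k \<and> part v = k then f u * f v else 0)"
      by (rule sum.swap)
    also have "\<dots> = (\<Sum>u\<in>?V. \<Sum>v\<in>?V. \<Sum>k<m. if part u = k \<and> part v = k then f u * f v else 0)"
      by (intro sum.cong refl sum.swap)
    also have "\<dots> = (\<Sum>u\<in>?V. \<Sum>v\<in>?V. if part u = part v then f u * f v else 0)"
    proof (intro sum.cong refl)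
      fix u v assume "u \<in> ?V" "v \<in> ?V"
      then have "part u < m" using part by auto
      have "(\<Sum>k<m. if part u = k \<and> part v = k then f u * f v else 0) =
          (\<Sum>k<m. if k = part u then (if part u = part v then f u * f v else 0) else 0)"
        by (intro sum.cong) auto
      then show "(\<Sum>k<m. if part u = k \<and> part v = k then f u * f v else 0) =
          (if part u = part v then f u * f v else 0)"
        using \<open>part u < m\<close> by simp
    qed
    finally have "(\<Sum>v\<in>?V. f v)\<^sup>2 - (\<Sum>k<m. (\<Sum>v\<in>?V. if part v = k then f v else 0)\<^sup>2) =
        (\<Sum>u\<in>?V. \<Sum>v\<in>?V. f u * f v - (if part u = part v then f u * f v else 0))"
      by (simp add: power2_eq_square sum_product sum_subtractf)
    also have "\<dots> = adj_form G f"
      unfolding adj_form_def by (intro sum.cong) (auto simp: arcs)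
    finally show ?thesis by simp
  qed
  then show "num_pos_eigenvalues G \<le> 1"
    by (intro num_pos_eigenvalues_le_1[OF G, of "\<lambda>_. 1"]) (simp add: sum_nonneg)
  have "0 \<in> part ` pverts G" "1 \<in> part ` pverts G"
    using part m by auto
  then obtain u v where "u \<in> pverts G" "v \<in> pverts G" "part u = 0" "part v = 1"
    by (metis imageE)
  then have "(u, v) \<in> parcs G" by (simp add: arcs)
  then show "1 \<le> num_pos_eigenvalues G"
    by (rule num_pos_eigenvalues_ge_1_arc[OF G])
qed

text \<open>The adjacency matrix is a product \<open>S * C\<close> through dimension
  \<open>m\<close>, and \<open>C * S\<close> is invertible. Up to powers of the indeterminate both
  products have the same characteristic polynomial, so 0 has multiplicity
  \<open>n - m\<close>.\<close>

lemma multipartite_nullity: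
  fixes part :: "'a \<Rightarrow> nat"
  assumes G: "pair_graph G"
    and arcs: "parcs G = {(u, v). u \<in> pverts G \<and> v \<in> pverts G \<and> part u \<noteq> part v}"
    and part: "part ` pverts G = {..<m}" and m: "m \<ge> 2"
  shows "nullity G + m = card (pverts G)"
proof -
  obtain xs where xs: "distinct xs" "set xs = pverts G"
    using finite_distinct_list[OF pair_graph_finite_verts[OF G]] by blast
  define n where "n = length xs"
  have n: "card (pverts G) = n" using xs by (metis distinct_card n_def)
  have part_lt: "part (xs ! i) < m" if "i < n" for i
    using that part xs n_def by (metis image_eqI lessThan_iff nth_mem)
  \<comment> \<open>\<open>S\<close> records which part a vertex lies in, and \<open>C\<close> which
    vertices lie outside a part; two vertices are adjacent iff the second lies outside the part of
    the first.\<close>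
  define S :: "real mat" where "S = Matrix.mat n m (\<lambda>(i, k). if part (xs ! i) = k then 1 else 0)"
  define C :: "real mat" where "C = Matrix.mat m n (\<lambda>(k, j). if part (xs ! j) \<noteq> k then 1 else 0)"
  have S: "S \<in> carrier_mat n m" and C: "C \<in> carrier_mat m n" by (simp_all add: S_def C_def)
  have SC: "S * C = adjacency_mat xs G"
  proof (rule eq_matI)
    fix i j assume "i < dim_row (adjacency_mat xs G)" "j < dim_col (adjacency_mat xs G)"
    then have ij: "i < n" "j < n" by (simp_all add: adjacency_mat_def n_def)
    then have "(S * C) $$ (i, j) = (\<Sum>k<m. (if part (xs ! i) = k then 1 else 0) *
        (if part (xs ! j) \<noteq> k then 1 else 0))"
      by (simp add: S_def C_def scalar_prod_def atLeast0LessThan)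
    also have "\<dots> = (\<Sum>k<m. if k = part (xs ! i) then (if part (xs ! j) \<noteq> part (xs ! i) then 1 else 0) else 0)"
      by (intro sum.cong) auto
    also have "\<dots> = adjacency_mat xs G $$ (i, j)"
      using ij part_lt xs nth_mem[of _ xs] by (auto simp: adjacency_mat_def n_def arcs)
    finally show "(S * C) $$ (i, j) = adjacency_mat xs G $$ (i, j)" .
  qed (auto simp: S_def C_def adjacency_mat_def n_def)
  define t where "t k = real (card {j. j < n \<and> part (xs ! j) = k})" for k
  have t_pos: "t k > 0" if k: "k < m" for k
  proof -
    obtain v where "v \<in> pverts G" "part v = k"
      using part k by (metis imageE lessThan_iff)
    then obtain j where "j < n" "part (xs ! j) = k"
      using xs by (metis in_set_conv_nth n_def)
    then have "{j. j < n \<and> part (xs ! j) = k} \<noteq> {}" by blast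
    then show ?thesis by (simp add: t_def card_gt_0_iff)
  qed
  \<comment> \<open>This is the quotient matrix: entry \<open>(k, l)\<close> is the number of
    neighbours in part \<open>l\<close> of a vertex in part \<open>k\<close>.\<close>
  have CS: "(C * S) $$ (k, l) = (if k = l then 0 else t l)" if "k < m" "l < m" for k l
  proof -
    have "(C * S) $$ (k, l) = (\<Sum>j<n. (if part (xs ! j) \<noteq> k then 1 else 0) *
        (if part (xs ! j) = l then 1 else 0))"
      using that by (simp add: S_def C_def scalar_prod_def atLeast0LessThan)
    also have "\<dots> = (\<Sum>j<n. if part (xs ! j) = l then (if k = l then 0 else 1) else 0)"
      by (intro sum.cong) auto
    also have "\<dots> = (\<Sum>j\<in>{j. j < n \<and> part (xs ! j) = l}. if k = l then 0 else 1)"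
      by (simp add: sum.If_cases Int_def)
    finally show ?thesis by (simp add: t_def)
  qed
  have CSc: "C * S \<in> carrier_mat m m" using C S by simp
  have "\<not> eigenvalue (C * S) 0"
  proof
    assume "eigenvalue (C * S) 0"
    then obtain y where y: "y \<in> carrier_vec m" "y \<noteq> 0\<^sub>v m" "(C * S) *\<^sub>v y = 0 \<cdot>\<^sub>v y"
      using CSc unfolding eigenvalue_def eigenvector_def by auto
    \<comment> \<open>Row \<open>k\<close> of the kernel equation says that
      \<open>t k * y $ k\<close> equals the total \<open>T\<close>. Summing over \<open>k\<close>
      gives \<open>T = m * T\<close>, so \<open>T = 0\<close> as \<open>m \<ge> 2\<close>, and then
      \<open>y = 0\<close> as all part sizes are positive.\<close>
    define T where "T = (\<Sum>l<m. t l * y $ l)"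
    have ty: "t k * y $ k = T" if k: "k < m" for k
    proof -
      have "0 = ((C * S) *\<^sub>v y) $ k" using y k by simp
      also have "\<dots> = (\<Sum>l<m. (C * S) $$ (k, l) * y $ l)"
        using CSc y(1) k by (simp add: mult_mat_vec_def scalar_prod_def atLeast0LessThan del: index_mult_mat)
      also have "\<dots> = (\<Sum>l<m. t l * y $ l - (if l = k then t l * y $ l else 0))"
        using k by (intro sum.cong) (auto simp: CS simp del: index_mult_mat)
      also have "\<dots> = T - t k * y $ k"
        using k by (simp add: sum_subtractf T_def)
      finally show ?thesis by simp
    qed
    have "(\<Sum>l<m. t l * y $ l) = (\<Sum>l<m. T)"
      by (intro sum.cong) (auto simp: ty)
    then have "T = real m * T"
      unfolding T_def[symmetric] by simp
    then have "T = 0" using m by simp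
    then have "y $ k = 0" if "k < m" for k
      using ty[OF that] t_pos[OF that] by simp
    then show False using y by (metis eq_vecI carrier_vecD index_zero_vec)
  qed
  then have CS0: "poly (char_poly (C * S)) 0 \<noteq> 0"
    using eigenvalue_root_char_poly[OF CSc] by blast
  have nz: "char_poly (S * C) \<noteq> 0"
    using degree_monic_char_poly[of "S * C" n] S C by (metis coeff_0 mult_carrier_mat zero_neq_one)
  have ord: "Polynomial.order 0 (monom 1 k :: real poly) = k" for k
    by (simp add: order_0_monom)
  \<comment> \<open>Comparing the multiplicity of the root 0 on both sides of the identity for the
    two products.\<close>
  have "m + Polynomial.order 0 (char_poly (S * C)) = n + Polynomial.order 0 (char_poly (C * S))"
    using arg_cong[OF char_poly_mult_commute[OF S C], of "Polynomial.order 0"] nz CS0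
    by (subst (asm) (1 2) order_mult) (auto simp: ord)
  moreover have "Polynomial.order 0 (char_poly (C * S)) = 0"
    using CS0 by (simp add: order_root)
  ultimately show ?thesis
    using nz by (simp add: nullity_def graph_spectrum_eq[OF xs] SC n)
qed

section \<open>Isomorphism and disjoint unions\<close>

text \<open>An arc is the pair of its ends, so the arc map of a digraph isomorphism is determined by
  its vertex map. Conversely, well-formedness makes the induced map on arcs injective.\<close>

lemma graph_iso_iff:
  assumes "pair_wf_digraph G"
  shows "G \<cong>\<^sub>g H \<longleftrightarrow>
    (\<exists>f. inj_on f (pverts G) \<and> pverts H = f ` pverts G \<and> parcs H = map_prod f f ` parcs G)"
    (is "_ \<longleftrightarrow> ?R")
proof
  assume "G \<cong>\<^sub>g H"
  then obtain h where h: "pre_digraph.digraph_isomorphism (with_proj G) h"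
    and H: "with_proj H = app_iso h (with_proj G)"
    by (auto simp: graph_iso_def digraph_iso_def)
  \<comment> \<open>Tail and head in \<open>with_proj\<close> are the projections, so equality of
    the two digraphs fixes the tail and head maps of \<open>h\<close>.\<close>
  have fst: "fst = iso_tail h" and snd: "snd = iso_head h"
    using arg_cong[OF H, of tail] arg_cong[OF H, of head] by simp_all
  have "iso_arcs h a = map_prod (iso_verts h) (iso_verts h) a" if "a \<in> parcs G" for a
    using h that unfolding pre_digraph.digraph_isomorphism_def
    by (intro prod_eqI) (auto simp: fst[symmetric] snd[symmetric])
  then have "parcs H = map_prod (iso_verts h) (iso_verts h) ` parcs G"
    using arg_cong[OF H, of arcs] by simp
  moreover have "pverts H = iso_verts h ` pverts G"
    using arg_cong[OF H, of verts] by simp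
  moreover have "inj_on (iso_verts h) (pverts G)"
    using h by (simp add: pre_digraph.digraph_isomorphism_def)
  ultimately show ?R by blast
next
  assume ?R
  then obtain f where f: "inj_on f (pverts G)" "pverts H = f ` pverts G" "parcs H = map_prod f f ` parcs G"
    by blast
  interpret pair_wf_digraph G by fact
  let ?h = "\<lparr>iso_verts = f, iso_arcs = map_prod f f, iso_head = snd, iso_tail = fst\<rparr>"
  have "inj_on (map_prod f f) (parcs G)"
    by (rule inj_on_subset[OF map_prod_inj_on[OF f(1) f(1)]]) (auto dest: in_arcsD1 in_arcsD2)
  then have "digraph_isomorphism ?h"
    using f(1) assms by (simp add: digraph_isomorphism_def wf_digraph_wp_iff)
  moreover have "with_proj H = app_iso ?h (with_proj G)"
    using f(2,3) by (simp add: app_iso_def with_proj_def)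
  ultimately show "G \<cong>\<^sub>g H"
    by (auto simp: graph_iso_def digraph_iso_def)
qed

text \<open>Carrying an enumeration of the vertices along the isomorphism reproduces the same
  adjacency matrix.\<close>

lemma graph_iso_spectrum:
  assumes G: "pair_graph G" and "G \<cong>\<^sub>g H"
  shows "graph_spectrum H = graph_spectrum G"
proof -
  obtain f where f: "inj_on f (pverts G)" "pverts H = f ` pverts G" "parcs H = map_prod f f ` parcs G"
    using assms(2) unfolding graph_iso_iff[OF pair_graph_wf[OF G]] by blast
  obtain xs where xs: "distinct xs" "set xs = pverts G"
    using finite_distinct_list[OF pair_graph_finite_verts[OF G]] by blast
  have ys: "distinct (map f xs)" "set (map f xs) = pverts H"
    using xs f by (auto simp: distinct_map)
  have "(f u, f v) \<in> parcs H \<longleftrightarrow> (u, v) \<in> parcs G" if "u \<in> pverts G" "v \<in> pverts G" for u v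
  proof
    assume "(f u, f v) \<in> parcs H"
    then obtain x y where xy: "(x, y) \<in> parcs G" "f u = f x" "f v = f y"
      by (auto simp: f(3))
    then have "u = x" "v = y"
      using that f(1) pair_graph_arc_verts[OF G xy(1)] by (auto dest: inj_onD)
    then show "(u, v) \<in> parcs G" using xy(1) by simp
  qed (force simp: f(3))
  then have "adjacency_mat (map f xs) H = adjacency_mat xs G"
    using xs(2) nth_mem[of _ xs] by (intro eq_matI) (auto simp: adjacency_mat_def)
  then show ?thesis
    by (simp add: graph_spectrum_eq[OF xs] graph_spectrum_eq[OF ys])
qed

text \<open>With the vertices of \<open>G\<close> listed before those of \<open>H\<close> the matrix
  is block diagonal, so the characteristic polynomial factors.\<close>

lemma graph_spectrum_disjoint_union:
  assumes G: "pair_graph G" and H: "pair_graph H"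
  shows "graph_spectrum (G \<oplus>\<^sub>g H) = graph_spectrum G + graph_spectrum H"
proof -
  obtain xs where xs: "distinct xs" "set xs = pverts G"
    using finite_distinct_list[OF pair_graph_finite_verts[OF G]] by blast
  obtain ys where ys: "distinct ys" "set ys = pverts H"
    using finite_distinct_list[OF pair_graph_finite_verts[OF H]] by blast
  let ?zs = "map Inl xs @ map Inr ys"
  have zs: "distinct ?zs" "set ?zs = pverts (G \<oplus>\<^sub>g H)"
    using xs ys by (auto simp: distinct_map disjoint_union_def)
  let ?n = "length xs" and ?m = "length ys"
  let ?A = "adjacency_mat xs G" and ?B = "adjacency_mat ys H"
  have "char_poly_matrix (adjacency_mat ?zs (G \<oplus>\<^sub>g H)) =
      four_block_mat (char_poly_matrix ?A) (0\<^sub>m ?n ?m) (0\<^sub>m ?m ?n) (char_poly_matrix ?B)"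
    by (rule eq_matI)
      (auto simp: char_poly_matrix_def adjacency_mat_def nth_append disjoint_union_def)
  then have "char_poly (adjacency_mat ?zs (G \<oplus>\<^sub>g H)) = char_poly ?A * char_poly ?B"
    unfolding char_poly_def
    by (simp add: det_four_block_mat_upper_right_zero[of _ ?n _ ?m])
  moreover have "char_poly ?A \<noteq> 0" "char_poly ?B \<noteq> 0"
    using degree_monic_char_poly[of ?A ?n] degree_monic_char_poly[of ?B ?m] by auto
  ultimately show ?thesis
    by (simp add: graph_spectrum_eq[OF xs] graph_spectrum_eq[OF ys] graph_spectrum_eq[OF zs] proots_mult)
qed

lemma num_pos_eigenvalues_iso:
  "pair_graph G \<Longrightarrow> G \<cong>\<^sub>g H \<Longrightarrow> num_pos_eigenvalues H = num_pos_eigenvalues G"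
  by (simp add: num_pos_eigenvalues_def graph_iso_spectrum)

lemma nullity_iso: "pair_graph G \<Longrightarrow> G \<cong>\<^sub>g H \<Longrightarrow> nullity H = nullity G"
  by (simp add: nullity_def graph_iso_spectrum)

lemma num_pos_eigenvalues_disjoint_union:
  "pair_graph G \<Longrightarrow> pair_graph H \<Longrightarrow>
    num_pos_eigenvalues (G \<oplus>\<^sub>g H) = num_pos_eigenvalues G + num_pos_eigenvalues H"
  by (simp add: num_pos_eigenvalues_def graph_spectrum_disjoint_union)

lemma nullity_disjoint_union:
  "pair_graph G \<Longrightarrow> pair_graph H \<Longrightarrow> nullity (G \<oplus>\<^sub>g H) = nullity G + nullity H"
  by (simp add: nullity_def graph_spectrum_disjoint_union)

lemma graph_spectrum_complete_graph_1: "graph_spectrum (complete_graph 1) = {#0#}"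
proof -
  have "distinct [0::nat]" "set [0::nat] = pverts (complete_graph 1)"
    by (auto simp: complete_graph_def)
  then have "graph_spectrum (complete_graph 1) = proots (char_poly (adjacency_mat [0::nat] (complete_graph 1)))"
    by (rule graph_spectrum_eq)
  also have "char_poly (adjacency_mat [0::nat] (complete_graph 1)) = [:0, 1:]"
    by (subst char_poly_upper_triangular[of _ 1])
      (auto simp: adjacency_mat_def complete_graph_def diag_mat_def)
  finally show ?thesis by simp
qed

lemma graph_spectrum_add_isolated:
  assumes "pair_graph G" "pair_graph H" "G \<cong>\<^sub>g H \<oplus>\<^sub>g complete_graph 1"
  shows "graph_spectrum G = add_mset 0 (graph_spectrum H)"
proof -
  have "graph_spectrum G = graph_spectrum (H \<oplus>\<^sub>g complete_graph 1)"
    using graph_iso_spectrum[OF assms(1,3)] by (rule sym)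
  also have "\<dots> = graph_spectrum H + {#0#}"
    unfolding graph_spectrum_disjoint_union[OF assms(2) pair_graph_complete_graph]
      graph_spectrum_complete_graph_1 by (rule refl)
  finally show ?thesis by simp
qed

section \<open>Induced subgraphs and decomposition along a vertex partition\<close>

definition induced_graph :: "'a pair_pre_digraph \<Rightarrow> 'a set \<Rightarrow> 'a pair_pre_digraph" where
  "induced_graph G U = \<lparr>pverts = U, parcs = parcs G \<inter> U \<times> U\<rparr>"

lemma induced_graph_simps [simp]:
  "pverts (induced_graph G U) = U" "parcs (induced_graph G U) = parcs G \<inter> U \<times> U"
  by (simp_all add: induced_graph_def)

lemma pair_graph_induced_graph:
  assumes G: "pair_graph G" and "U \<subseteq> pverts G"
  shows "pair_graph (induced_graph G U)"
  by (rule pair_graphI)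
    (use assms pair_graph_finite_verts[OF G] pair_graph_arc_sym[OF G] pair_graph_irrefl[OF G]
      in \<open>auto intro: finite_subset\<close>)

lemma graph_iso_refl: "pair_graph G \<Longrightarrow> G \<cong>\<^sub>g G"
  by (subst graph_iso_iff[OF pair_graph_wf]) (auto intro!: exI[of _ id] simp: map_prod.id)

text \<open>The two isomorphisms glue along \<open>U\<close> and \<open>W\<close>: by symmetry
  \<open>no_arcs\<close> excludes arcs in both directions, so every arc lies within one
  side.\<close>

lemma graph_iso_disjoint_union_split:
  assumes G: "pair_graph G" and V: "pverts G = U \<union> W" "U \<inter> W = {}"
    and no_arcs: "\<And>u w. u \<in> U \<Longrightarrow> w \<in> W \<Longrightarrow> (u, w) \<notin> parcs G"
    and K: "induced_graph G U \<cong>\<^sub>g K" and L: "induced_graph G W \<cong>\<^sub>g L"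
  shows "G \<cong>\<^sub>g K \<oplus>\<^sub>g L"
proof -
  have wf: "pair_wf_digraph (induced_graph G U)" "pair_wf_digraph (induced_graph G W)"
    using V(1) by (auto intro!: pair_graph_wf pair_graph_induced_graph[OF G])
  obtain f where f: "inj_on f U" "pverts K = f ` U" "parcs K = map_prod f f ` (parcs G \<inter> U \<times> U)"
    using K unfolding graph_iso_iff[OF wf(1)] by auto
  obtain g where g: "inj_on g W" "pverts L = g ` W" "parcs L = map_prod g g ` (parcs G \<inter> W \<times> W)"
    using L unfolding graph_iso_iff[OF wf(2)] by auto
  define h where "h v = (if v \<in> U then Inl (f v) else Inr (g v))" for v
  have hU: "h v = Inl (f v)" if "v \<in> U" for v using that by (simp add: h_def)
  have hW: "h v = Inr (g v)" if "v \<in> W" for v using that V(2) by (auto simp: h_def)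
  have "inj_on h (pverts G)"
  proof (rule inj_onI)
    fix a b assume "a \<in> pverts G" "b \<in> pverts G" "h a = h b"
    then show "a = b"
      using f(1) g(1) by (auto simp: V(1) hU hW dest: inj_onD)
  qed
  moreover have "pverts (K \<oplus>\<^sub>g L) = h ` pverts G"
  proof -
    have "h ` U = Inl ` pverts K" "h ` W = Inr ` pverts L"
      unfolding f(2) g(2) image_image using hU hW by (auto intro!: image_cong)
    then show ?thesis
      by (simp add: V(1) image_Un disjoint_union_def Plus_def)
  qed
  moreover have "parcs (K \<oplus>\<^sub>g L) = map_prod h h ` parcs G"
  proof -
    have "parcs G = (parcs G \<inter> U \<times> U) \<union> (parcs G \<inter> W \<times> W)"
    proof (intro equalityI subrelI)
      fix u v assume uv: "(u, v) \<in> parcs G"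
      then have "u \<in> U \<or> u \<in> W" "v \<in> U \<or> v \<in> W"
        using pair_graph_arc_verts[OF G uv] V(1) by auto
      then show "(u, v) \<in> (parcs G \<inter> U \<times> U) \<union> (parcs G \<inter> W \<times> W)"
        using uv no_arcs[of u v] no_arcs[of v u] pair_graph_arc_sym[OF G uv] by auto
    qed auto
    then have "map_prod h h ` parcs G =
        map_prod h h ` (parcs G \<inter> U \<times> U) \<union> map_prod h h ` (parcs G \<inter> W \<times> W)"
      by (metis image_Un)
    also have "map_prod h h ` (parcs G \<inter> U \<times> U) = map_prod Inl Inl ` parcs K"
      unfolding f(3) image_image by (rule image_cong) (auto simp: hU)
    also have "map_prod h h ` (parcs G \<inter> W \<times> W) = map_prod Inr Inr ` parcs L"
      unfolding g(3) image_image by (rule image_cong) (auto simp: hW)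
    finally show ?thesis
      by (auto simp: disjoint_union_def image_iff)
  qed
  ultimately show ?thesis
    unfolding graph_iso_iff[OF pair_graph_wf[OF G]] by blast
qed

section \<open>Graphs with one positive eigenvalue\<close>

text \<open>The first component of a vertex serves as its part. As all sizes are positive, the
  truncated differences \<open>t - 1\<close> add up to the number of vertices minus the number of
  parts.\<close>

lemma complete_multipartite_eigenvalues:
  assumes len: "length ts \<ge> 2" and pos: "\<forall>t\<in>set ts. t > 0"
  shows "num_pos_eigenvalues (complete_multipartite ts) = 1"
    and "nullity (complete_multipartite ts) = (\<Sum>t\<leftarrow>ts. t - 1)"
proof -
  let ?G = "complete_multipartite ts"
  have arcs: "parcs ?G = {(u, v). u \<in> pverts ?G \<and> v \<in> pverts ?G \<and> fst u \<noteq> fst v}"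
    by (simp add: complete_multipartite_def Let_def)
  have "ts ! i > 0" if "i < length ts" for i using pos that by simp
  then have part: "fst ` pverts ?G = {..<length ts}"
    by (force simp: complete_multipartite_def Let_def image_iff)
  note G = pair_graph_complete_multipartite[of ts]
  show "num_pos_eigenvalues ?G = 1"
    by (rule multipartite_num_pos_eigenvalues[OF G arcs part len])
  have "(\<Sum>t\<leftarrow>ts. t - 1) + length ts = sum_list ts"
    using pos by (induction ts) auto
  then show "nullity ?G = (\<Sum>t\<leftarrow>ts. t - 1)"
    using multipartite_nullity[OF G arcs part len] by (simp add: card_pverts_complete_multipartite)
qed

text \<open>\<open>cotrans\<close> is the contrapositive of transitivity of non-adjacency.
  Non-adjacency is therefore an equivalence relation, whose classes become the parts; the given arc
  supplies two of them.\<close>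

lemma graph_iso_complete_multipartite:
  assumes G: "pair_graph G" and arc: "(a, b) \<in> parcs G"
    and cotrans: "\<And>u v w. (u, v) \<in> parcs G \<Longrightarrow> w \<in> pverts G \<Longrightarrow>
      (u, w) \<in> parcs G \<or> (w, v) \<in> parcs G"
  shows "\<exists>ts. length ts \<ge> 2 \<and> (\<forall>t\<in>set ts. t > 0) \<and> G \<cong>\<^sub>g complete_multipartite ts"
proof -
  define R where "R = {(u, v). u \<in> pverts G \<and> v \<in> pverts G \<and> (u, v) \<notin> parcs G}"
  note fin = pair_graph_finite_verts[OF G]
  have equiv: "equiv (pverts G) R"
    by (rule equivI)
      (use cotrans pair_graph_irrefl[OF G] pair_graph_arc_sym[OF G] in
        \<open>auto simp: R_def refl_on_def sym_def trans_def\<close>)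
  obtain Cs where Cs: "distinct Cs" "set Cs = pverts G // R"
    using finite_distinct_list[of "pverts G // R"] finite_quotient[of "pverts G" R] fin
    by (auto simp: R_def)
  have finC: "finite C" if "C \<in> set Cs" for C
    using that Cs(2) fin in_quotient_imp_subset[OF equiv] finite_subset by metis
  have neC: "C \<noteq> {}" if "C \<in> set Cs" for C
    using that Cs(2) in_quotient_imp_non_empty[OF equiv] by metis
  have unique: "i = j" if "i < length Cs" "j < length Cs" "v \<in> Cs ! i" "v \<in> Cs ! j" for i j v
    using that Cs quotient_disj[OF equiv, of "Cs ! i" "Cs ! j"]
    by (metis IntI empty_iff nth_eq_iff_index_eq nth_mem)
  have "\<exists>i<length Cs. v \<in> Cs ! i" if "v \<in> pverts G" for v
    using that Cs(2) Union_quotient[OF equiv] by (metis UnionE in_set_conv_nth)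
  then obtain idx where idx: "\<And>v. v \<in> pverts G \<Longrightarrow> idx v < length Cs \<and> v \<in> Cs ! idx v"
    by metis
  have sub: "Cs ! i \<subseteq> pverts G" if "i < length Cs" for i
    using that Cs(2) in_quotient_imp_subset[OF equiv] nth_mem by metis
  have idx_eq: "idx v = i" if "i < length Cs" "v \<in> Cs ! i" for i v
    using that idx sub unique by blast
  have "\<exists>h. bij_betw h C {0..<card C}" if "C \<in> set Cs" for C
    using ex_bij_betw_finite_nat[OF finC[OF that]] .
  then obtain h where h: "\<And>C. C \<in> set Cs \<Longrightarrow> bij_betw (h C) C {0..<card C}"
    by metis
  define ts where "ts = map card Cs"
  \<comment> \<open>A vertex goes to the index of its class together with its number in a fixed
    numbering of that class.\<close>
  define f where "f v = (idx v, h (Cs ! idx v) v)" for v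
  have adj: "(u, v) \<in> parcs G \<longleftrightarrow> idx u \<noteq> idx v" if uv: "u \<in> pverts G" "v \<in> pverts G" for u v
  proof -
    have "idx u = idx v \<longleftrightarrow> (u, v) \<in> R"
    proof
      assume "idx u = idx v"
      then show "(u, v) \<in> R"
        using idx[OF uv(1)] idx[OF uv(2)] Cs(2) quotient_eq_iff[OF equiv] nth_mem by metis
    next
      assume "(u, v) \<in> R"
      then have "Cs ! idx u = Cs ! idx v"
        using idx[OF uv(1)] idx[OF uv(2)] Cs(2) quotient_eq_iff[OF equiv] nth_mem by metis
      then show "idx u = idx v"
        using idx[OF uv(1)] idx[OF uv(2)] Cs(1) nth_eq_iff_index_eq by metis
    qed
    then show ?thesis using uv by (auto simp: R_def)
  qed
  have inj: "inj_on f (pverts G)"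
  proof (rule inj_onI)
    fix u v assume uv: "u \<in> pverts G" "v \<in> pverts G" "f u = f v"
    then have "idx u = idx v"
      by (simp add: f_def)
    moreover from this have "h (Cs ! idx u) u = h (Cs ! idx u) v"
      using uv(3) by (simp add: f_def)
    ultimately show "u = v"
      using h[of "Cs ! idx u"] idx[OF uv(1)] idx[OF uv(2)]
      by (metis bij_betw_imp_inj_on inj_onD nth_mem)
  qed
  have img: "f ` pverts G = pverts (complete_multipartite ts)"
  proof (intro equalityI subsetI)
    fix p assume "p \<in> f ` pverts G"
    then obtain v where v: "v \<in> pverts G" "p = f v" by blast
    then have "h (Cs ! idx v) v \<in> {0..<card (Cs ! idx v)}"
      using h[of "Cs ! idx v"] idx[OF v(1)] by (metis bij_betwE nth_mem)
    then show "p \<in> pverts (complete_multipartite ts)"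
      using idx[OF v(1)] by (simp add: v(2) f_def ts_def complete_multipartite_def Let_def)
  next
    fix p assume "p \<in> pverts (complete_multipartite ts)"
    then obtain i j where p: "p = (i, j)" "i < length Cs" "j < card (Cs ! i)"
      by (auto simp: complete_multipartite_def Let_def ts_def)
    then have "j \<in> h (Cs ! i) ` (Cs ! i)"
      using h[of "Cs ! i"] by (simp add: bij_betw_def)
    then obtain v where "v \<in> Cs ! i" "h (Cs ! i) v = j" by blast
    then show "p \<in> f ` pverts G"
      using p idx_eq[of i v] sub[of i] by (auto simp: f_def image_iff intro!: bexI[of _ v])
  qed
  have "parcs (complete_multipartite ts) =
      {(p, q). p \<in> f ` pverts G \<and> q \<in> f ` pverts G \<and> fst p \<noteq> fst q}"
    unfolding img by (simp add: complete_multipartite_def Let_def)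
  also have "\<dots> = map_prod f f ` parcs G"
  proof (intro equalityI subrelI)
    fix p q assume "(p, q) \<in> {(p, q). p \<in> f ` pverts G \<and> q \<in> f ` pverts G \<and> fst p \<noteq> fst q}"
    then obtain u v where uv: "u \<in> pverts G" "v \<in> pverts G" "p = f u" "q = f v" "fst p \<noteq> fst q"
      by blast
    then have "(u, v) \<in> parcs G" by (simp add: adj f_def)
    then show "(p, q) \<in> map_prod f f ` parcs G" using uv(3,4) by force
  next
    fix p q assume "(p, q) \<in> map_prod f f ` parcs G"
    then obtain u v where uv: "(u, v) \<in> parcs G" "p = f u" "q = f v" by auto
    have "u \<in> pverts G" "v \<in> pverts G" using pair_graph_arc_verts[OF G uv(1)] by auto
    moreover from this have "fst p \<noteq> fst q" using uv adj by (simp add: f_def)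
    ultimately show "(p, q) \<in> {(p, q). p \<in> f ` pverts G \<and> q \<in> f ` pverts G \<and> fst p \<noteq> fst q}"
      using uv(2,3) by blast
  qed
  finally have "G \<cong>\<^sub>g complete_multipartite ts"
    unfolding graph_iso_iff[OF pair_graph_wf[OF G]] using inj img by blast
  moreover have "\<forall>t\<in>set ts. t > 0"
    using finC neC by (auto simp: ts_def card_gt_0_iff)
  moreover have "length ts \<ge> 2"
  proof -
    have ab: "a \<in> pverts G" "b \<in> pverts G" using pair_graph_arc_verts[OF G arc] by auto
    then have "idx a \<noteq> idx b" using adj arc by blast
    then show ?thesis using idx[OF ab(1)] idx[OF ab(2)] by (simp add: ts_def)
  qed
  ultimately show ?thesis by blast
qed

text \<open>If cotransitivity fails, some \<open>w\<close> is adjacent to neither end of an edge;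
  any neighbour of \<open>w\<close> completes the configuration that forces two positive
  eigenvalues.\<close>

lemma one_pos_eigenvalue_imp_complete_multipartite:
  assumes G: "pair_graph G" and one: "num_pos_eigenvalues G = 1" and ne: "pverts G \<noteq> {}"
    and no_isolated: "\<And>v. v \<in> pverts G \<Longrightarrow> \<exists>w. (v, w) \<in> parcs G"
  shows "\<exists>ts. length ts \<ge> 2 \<and> (\<forall>t\<in>set ts. t > 0) \<and> G \<cong>\<^sub>g complete_multipartite ts"
proof -
  obtain a b where ab: "(a, b) \<in> parcs G" using ne no_isolated by blast
  show ?thesis
  proof (rule graph_iso_complete_multipartite[OF G ab])
    fix u v w assume uv: "(u, v) \<in> parcs G" and w: "w \<in> pverts G"
    obtain x where "(w, x) \<in> parcs G" using no_isolated[OF w] by blast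
    then show "(u, w) \<in> parcs G \<or> (w, v) \<in> parcs G"
      using num_pos_eigenvalues_ge_2_arcs[OF G uv] one pair_graph_arc_sym[OF G] by fastforce
  qed
qed

section \<open>Disconnected graphs with two positive eigenvalues\<close>

text \<open>\<open>U\<close> consists of the vertices reachable from some \<open>a\<close> that does
  not reach every vertex; a reachable set has no outgoing arcs.\<close>

lemma not_connected_split:
  assumes G: "pair_graph G" and ne: "pverts G \<noteq> {}" and "\<not> graph_connected G"
  obtains U W where "pverts G = U \<union> W" "U \<inter> W = {}" "U \<noteq> {}" "W \<noteq> {}"
    "\<And>u w. u \<in> U \<Longrightarrow> w \<in> W \<Longrightarrow> (u, w) \<notin> parcs G"
proof -
  interpret pair_graph G by fact
  \<comment> \<open>Connectedness means strong connectedness of the symmetric closure, which also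
    demands a vertex. As there is one, reachability must fail for some pair.\<close>
  have "\<exists>a\<in>pverts G. \<exists>b\<in>pverts G. \<not> a \<rightarrow>\<^sup>*\<^bsub>mk_symmetric (with_proj G)\<^esub> b"
    using assms(2,3)
    by (auto simp: graph_connected_def Digraph_Component.connected_def strongly_connected_def)
  \<comment> \<open>The arcs are already symmetric, so the closure has the same reachability
    relation.\<close>
  then obtain a b where ab: "a \<in> pverts G" "b \<in> pverts G" "\<not> a \<rightarrow>\<^sup>*\<^bsub>with_proj G\<^esub> b"
    using reachable_mk_symmetric_eq[OF pair_sym_arcs] by auto
  define U where "U = {v. a \<rightarrow>\<^sup>*\<^bsub>with_proj G\<^esub> v}"
  have "U \<subseteq> pverts G" by (auto simp: U_def dest: reachable_in_verts)
  moreover have "a \<in> U" using ab by (simp add: U_def)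
  moreover have "w \<in> U" if "u \<in> U" "(u, w) \<in> parcs G" for u w
    using that by (auto simp: U_def intro: reachable_adj_trans)
  ultimately show ?thesis
    using ab by (intro that[of U "pverts G - U"]) (auto simp: U_def)
qed

text \<open>A graph with a single part has no edge and hence no positive eigenvalue, so both lists
  have length at least two. Taking \<open>H\<close> on natural numbers loses nothing, since finite
  vertex sets can be renumbered.\<close>

theorem theorem4p1:
  fixes G :: "'a pair_pre_digraph" and n s :: nat
  assumes "pair_graph G"
    and "card (pverts G) = n"
    and "\<not> graph_connected G"
    and "n \<ge> 6"
    and "2 \<le> s" and "s \<le> n - 3"
  shows "G \<in> \<G> s n \<longleftrightarrow>
      (\<exists>H :: nat pair_pre_digraph. H \<in> \<G> (s - 1) (n - 1) \<and> G \<cong>\<^sub>g H \<oplus>\<^sub>g complete_graph 1)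
    \<or> (\<exists>ts rs :: nat list.
          length ts \<ge> 2 \<and> length rs \<ge> 2 \<and> (\<forall>t\<in>set ts. t > 0) \<and> (\<forall>r\<in>set rs. r > 0)
        \<and> G \<cong>\<^sub>g complete_multipartite ts \<oplus>\<^sub>g complete_multipartite rs
        \<and> (\<Sum>t\<leftarrow>ts. t - 1) + (\<Sum>r\<leftarrow>rs. r - 1) = s)"
  (is "_ \<longleftrightarrow> ?isolated \<or> ?multipartite")
proof
  note G = assms(1)
  note fin = pair_graph_finite_verts[OF G]
  assume "G \<in> \<G> s n"
  then have two: "num_pos_eigenvalues G = 2" and null: "nullity G = s"
    by (auto simp: two_pos_graphs_def)
  show "?isolated \<or> ?multipartite"
  proof (cases "\<exists>v\<in>pverts G. \<forall>w. (v, w) \<notin> parcs G")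
    case True
    then obtain v where v: "v \<in> pverts G" "\<And>w. (v, w) \<notin> parcs G" by blast
    let ?U = "pverts G - {v}"
    have U: "card ?U = n - 1" "finite ?U" using assms(2) v(1) fin by auto
    \<comment> \<open>\<open>f\<close> numbers the vertices other than \<open>v\<close>, moving the
      rest of the graph to natural numbers.\<close>
    obtain f where f: "bij_betw f ?U {0..<n - 1}"
      using ex_bij_betw_finite_nat[OF U(2)] U(1) by auto
    have GU: "pair_graph (induced_graph G ?U)"
      by (rule pair_graph_induced_graph[OF G]) auto
    define H where "H = \<lparr>pverts = {0..<n - 1}, parcs = map_prod f f ` (parcs G \<inter> ?U \<times> ?U)\<rparr>"
    have inj: "inj_on f ?U" and img: "f ` ?U = {0..<n - 1}" using f by (auto simp: bij_betw_def)
    have GH: "induced_graph G ?U \<cong>\<^sub>g H"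
      unfolding graph_iso_iff[OF pair_graph_wf[OF GU]]
      by (rule exI[of _ f]) (simp add: H_def inj img)
    have H: "pair_graph H"
    proof (rule pair_graphI)
      show "parcs H \<subseteq> pverts H \<times> pverts H" using img by (auto simp: H_def)
      show "(y, x) \<in> parcs H" if "(x, y) \<in> parcs H" for x y
        using that pair_graph_arc_sym[OF G] by (force simp: H_def)
      show "(x, x) \<notin> parcs H" for x
        using inj pair_graph_irrefl[OF G] by (auto simp: H_def dest: inj_onD)
    qed (simp add: H_def)
    have "induced_graph G {v} \<cong>\<^sub>g complete_graph 1"
      using v pair_graph_wf[OF pair_graph_induced_graph[OF G, of "{v}"]]
      by (subst graph_iso_iff) (auto intro!: exI[of _ "\<lambda>_. 0"] simp: complete_graph_def)
    with GH have iso: "G \<cong>\<^sub>g H \<oplus>\<^sub>g complete_graph 1"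
      by (intro graph_iso_disjoint_union_split[OF G, of ?U "{v}"])
        (use v pair_graph_arc_sym[OF G] in auto)
    have "num_pos_eigenvalues H = 2" "nullity H = s - 1"
      using graph_spectrum_add_isolated[OF G H iso] two null
      by (simp_all add: num_pos_eigenvalues_def nullity_def)
    moreover have "card (pverts H) = n - 1" by (simp add: H_def)
    ultimately show ?thesis
      using H iso by (auto simp: two_pos_graphs_def)
  next
    case False
    have "pverts G \<noteq> {}" using assms(2,4) by auto
    then obtain U W where UW: "pverts G = U \<union> W" "U \<inter> W = {}" "U \<noteq> {}" "W \<noteq> {}"
      and no_arcs: "\<And>u w. u \<in> U \<Longrightarrow> w \<in> W \<Longrightarrow> (u, w) \<notin> parcs G"
      using not_connected_split[OF G _ assms(3)] by metis
    let ?GU = "induced_graph G U" and ?GW = "induced_graph G W"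
    have GU: "pair_graph ?GU" and GW: "pair_graph ?GW"
      using UW(1) by (auto intro!: pair_graph_induced_graph[OF G])
    have nbU: "\<exists>w. (v, w) \<in> parcs ?GU" if "v \<in> U" for v
    proof -
      have "v \<in> pverts G" using that UW(1) by simp
      then obtain w where w: "(v, w) \<in> parcs G" using False by blast
      then have "w \<in> U" using no_arcs[OF that, of w] pair_graph_arc_verts(2)[OF G w] UW(1) by auto
      then show ?thesis using w that by auto
    qed
    have nbW: "\<exists>w. (v, w) \<in> parcs ?GW" if "v \<in> W" for v
    proof -
      have "v \<in> pverts G" using that UW(1) by simp
      then obtain w where w: "(v, w) \<in> parcs G" using False by blast
      then have "w \<in> W"
        using no_arcs[OF _ that, of w] pair_graph_arc_sym[OF G w] pair_graph_arc_verts(2)[OF G w] UW(1)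
        by auto
      then show ?thesis using w that by auto
    qed
    have iso: "G \<cong>\<^sub>g ?GU \<oplus>\<^sub>g ?GW"
      by (rule graph_iso_disjoint_union_split[OF G UW(1,2) no_arcs])
        (auto intro: graph_iso_refl GU GW)
    have "num_pos_eigenvalues ?GU + num_pos_eigenvalues ?GW = 2"
      using num_pos_eigenvalues_iso[OF G iso] two
      by (simp add: num_pos_eigenvalues_disjoint_union[OF GU GW])
    \<comment> \<open>Both sides contain an edge, so neither can take both of the positive
      eigenvalues.\<close>
    moreover have "num_pos_eigenvalues ?GU \<ge> 1" "num_pos_eigenvalues ?GW \<ge> 1"
      using nbU nbW UW(3,4) num_pos_eigenvalues_ge_1_arc[OF GU] num_pos_eigenvalues_ge_1_arc[OF GW]
      by blast+
    ultimately have one: "num_pos_eigenvalues ?GU = 1" "num_pos_eigenvalues ?GW = 1" by auto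
    obtain ts where ts: "length ts \<ge> 2" "\<forall>t\<in>set ts. t > 0" "?GU \<cong>\<^sub>g complete_multipartite ts"
      using one_pos_eigenvalue_imp_complete_multipartite[OF GU one(1)] nbU UW(3) by auto
    obtain rs where rs: "length rs \<ge> 2" "\<forall>r\<in>set rs. r > 0" "?GW \<cong>\<^sub>g complete_multipartite rs"
      using one_pos_eigenvalue_imp_complete_multipartite[OF GW one(2)] nbW UW(4) by auto
    have iso': "G \<cong>\<^sub>g complete_multipartite ts \<oplus>\<^sub>g complete_multipartite rs"
      by (rule graph_iso_disjoint_union_split[OF G UW(1,2) no_arcs ts(3) rs(3)])
    have "(\<Sum>t\<leftarrow>ts. t - 1) + (\<Sum>r\<leftarrow>rs. r - 1) = s"
      using nullity_iso[OF G iso'] null complete_multipartite_eigenvalues(2)[OF ts(1,2)]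
        complete_multipartite_eigenvalues(2)[OF rs(1,2)]
      by (simp add: nullity_disjoint_union pair_graph_complete_multipartite)
    then show ?thesis using ts rs iso' by blast
  qed
next
  note G = assms(1)
  assume "?isolated \<or> ?multipartite"
  then have "num_pos_eigenvalues G = 2 \<and> nullity G = s"
  proof
    assume ?isolated
    then obtain H :: "nat pair_pre_digraph" where H: "pair_graph H" "num_pos_eigenvalues H = 2"
        "nullity H = s - 1" and iso: "G \<cong>\<^sub>g H \<oplus>\<^sub>g complete_graph 1"
      by (auto simp: two_pos_graphs_def)
    \<comment> \<open>The added vertex raises the nullity by one; \<open>2 \<le> s\<close> ensures
      that adding 1 to the truncated \<open>s - 1\<close> gives back \<open>s\<close>.\<close>
    then show ?thesis
      using graph_spectrum_add_isolated[OF G H(1) iso] H(2,3) assms(5)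
      by (simp add: num_pos_eigenvalues_def nullity_def)
  next
    assume ?multipartite
    then obtain ts rs where ts: "length ts \<ge> 2" "\<forall>t\<in>set ts. t > 0"
      and rs: "length rs \<ge> 2" "\<forall>r\<in>set rs. r > 0"
      and iso: "G \<cong>\<^sub>g complete_multipartite ts \<oplus>\<^sub>g complete_multipartite rs"
      and s: "(\<Sum>t\<leftarrow>ts. t - 1) + (\<Sum>r\<leftarrow>rs. r - 1) = s"
      by blast
    show ?thesis
      using num_pos_eigenvalues_iso[OF G iso] nullity_iso[OF G iso] s
        complete_multipartite_eigenvalues[OF ts] complete_multipartite_eigenvalues[OF rs]
      by (simp add: num_pos_eigenvalues_disjoint_union nullity_disjoint_union
          pair_graph_complete_multipartite)
  qed
  then show "G \<in> \<G> s n"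
    using assms(1,2) by (simp add: two_pos_graphs_def)
qed

end
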